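(* The relation of topological isomorphism between oligomorphic closed subgroups of $S_\infty$ is essentially countable; that is, it is Borel reducible to a Borel equivalence relation (on a standard Borel space) all of whose equivalence classes are countable.
   Context: $S_\infty$ is the Polish group of all permutations of $\omega$ with the topology of pointwise convergence. A closed subgroup $G$ of $S_\infty$ is oligomorphic if for every $n\ge1$ the natural action of $G$ on $\omega^n$ has only finitely many orbits. The set of oligomorphic closed subgroups is a Borel subset of the Effros Borel space of $S_\infty$ (closed subsets of $S_\infty$ with the $\sigma$-algebra generated by $\{D: D\cap U\ne\emptyset\}$, $U$ open). For equivalence relations $E$ on $X$ and $F$ on $Y$ (standard Borel spaces), $E$ is Borel reducible to $F$ if there is a Borel map $f\colon X\to Y$ with $x_0\,E\,x_1\iff f(x_0)\,F\,f(x_1)$ for all $x_0,x_1\in X$. *)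

theory Defs
  imports "HOL-Analysis.Analysis" "HOL-Algebra.Group_Action"
begin

text \<open>Since \<^typ>\<open>nat\<close> is discrete, the library topology on \<^typ>\<open>nat \<Rightarrow> nat\<close> is the product
  topology of Baire space; \<open>Sinf_top\<close> is therefore the topology of pointwise convergence.\<close>

abbreviation Sinf :: "(nat \<Rightarrow> nat) monoid" where
  "Sinf \<equiv> BijGroup UNIV"

abbreviation Sinf_top :: "(nat \<Rightarrow> nat) topology" where
  "Sinf_top \<equiv> top_of_set (carrier Sinf)"

definition closed_subgroup :: "(nat \<Rightarrow> nat) set \<Rightarrow> bool" where
  "closed_subgroup G \<longleftrightarrow> subgroup G Sinf \<and> closedin Sinf_top G"

text \<open>An \<open>n\<close>-tuple is a list of length \<open>n\<close>, on which a permutation acts by \<^const>\<open>map\<close>.\<close>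

definition oligomorphic :: "(nat \<Rightarrow> nat) set \<Rightarrow> bool" where
  "oligomorphic G \<longleftrightarrow> closed_subgroup G \<and>
     (\<forall>n\<ge>1. finite (orbits (Sinf\<lparr>carrier := G\<rparr>) {xs :: nat list. length xs = n} map))"

definition topologically_isomorphic :: "(nat \<Rightarrow> nat) set \<Rightarrow> (nat \<Rightarrow> nat) set \<Rightarrow> bool" where
  "topologically_isomorphic G H \<longleftrightarrow>
     (\<exists>\<phi>. \<phi> \<in> iso (Sinf\<lparr>carrier := G\<rparr>) (Sinf\<lparr>carrier := H\<rparr>) \<and>
          homeomorphic_map (subtopology Sinf_top G) (subtopology Sinf_top H) \<phi>)"

text \<open>Measurable spaces are represented by the type \<open>measure\<close>; only the underlying set and the
  \<open>\<sigma>\<close>-algebra matter below.\<close>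

definition effros_borel :: "'a topology \<Rightarrow> 'a set measure" where
  "effros_borel X =
     sigma {D. closedin X D} {{D. closedin X D \<and> D \<inter> U \<noteq> {}} | U. openin X U}"

definition oligomorphic_groups :: "(nat \<Rightarrow> nat) set measure" where
  "oligomorphic_groups = restrict_space (effros_borel Sinf_top) {G. oligomorphic G}"

definition oligomorphic_iso :: "(nat \<Rightarrow> nat) set rel" where
  "oligomorphic_iso =
     {(G, H). oligomorphic G \<and> oligomorphic H \<and> topologically_isomorphic G H}"

definition standard_borel :: "'a measure \<Rightarrow> bool" where
  "standard_borel M \<longleftrightarrow>
     (\<exists>X. completely_metrizable_space X \<and> separable_space X \<and>
          space M = topspace X \<and> sets M = sigma_sets (topspace X) {U. openin X U})"

definition borel_reducible ::
  "'a measure \<Rightarrow> 'a rel \<Rightarrow> 'b measure \<Rightarrow> 'b rel \<Rightarrow> bool" where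
  "borel_reducible M E N F \<longleftrightarrow>
     (\<exists>f \<in> measurable M N. \<forall>x\<in>space M. \<forall>y\<in>space M. (x, y) \<in> E \<longleftrightarrow> (f x, f y) \<in> F)"

definition countable_borel_equiv :: "'a measure \<Rightarrow> 'a rel \<Rightarrow> bool" where
  "countable_borel_equiv N F \<longleftrightarrow>
     equiv (space N) F \<and> F \<in> sets (N \<Otimes>\<^sub>M N) \<and> (\<forall>C \<in> space N // F. countable C)"

text \<open>HOL cannot quantify over the type carrying the target space. Fixing \<^typ>\<open>nat \<Rightarrow> nat\<close> loses
  no generality: a standard Borel space has at most continuum many points, so it is Borel
  isomorphic to a standard Borel space whose underlying set is a subset of \<^typ>\<open>nat \<Rightarrow> nat\<close>.\<close>

definition essentially_countable :: "'a measure \<Rightarrow> 'a rel \<Rightarrow> bool" where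
  "essentially_countable M E \<longleftrightarrow>
     (\<exists>(N :: (nat \<Rightarrow> nat) measure) F.
        standard_borel N \<and> countable_borel_equiv N F \<and> borel_reducible M E N F)"

end

theory Submission
  imports Defs
begin

text \<open>
  An oligomorphic group \<open>G\<close> is viewed as the structure on the natural numbers whose relations
  say that two tuples lie in the same \<open>G\<close>-orbit. There are finitely many orbits on \<open>n\<close>-tuples, so every type
  is isolated by a formula, and back and forth shows that the theory of this structure determines
  \<open>G\<close> up to conjugacy in \<open>S\<^sub>\<infinity>\<close>. The theory, a point of Baire space, is the Borel reduction.

  A topological isomorphism from \<open>G\<close> to \<open>H\<close> turns \<open>H\<close> into a faithful action of \<open>G\<close> on finitely many
  quotients of orbits of tuples. Finitely many parameters name the orbits involved, and the parameters
  may be replaced by a formula isolating their type. So the theory of \<open>H\<close> is obtained from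
  the theory of \<open>G\<close> by one of countably many Borel maps; conversely, applying such a map
  to the theory of \<open>G\<close> gives the theory of some oligomorphic group isomorphic to \<open>G\<close>. The relation of being
  mapped to each other by compositions of these maps is the required countable Borel
  equivalence relation.
\<close>

subsection \<open>Orbit structures and their formulas\<close>

text \<open>Orbits carry no names on purpose: the structure records only whether two tuples share an
  orbit, so no enumeration of the orbits has to be chosen. The price is that its automorphisms form
  the normaliser of \<open>G\<close> in the group of all permutations, which may fuse several orbits
  into one type. A single orbit can therefore be addressed only through a sample tuple, and this is
  why interpretations carry parameters. The language is not first-order: \<open>Faithful\<close>
  quantifies over finite lists of tuples of unbounded length, and interpretations nest. No
  compactness is used, so nothing is lost. What counts is that there are countably many formulas,
  that satisfaction is invariant under isomorphism, and that it depends on the structure in a Borel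
  way. Isolation of types then follows from Boolean combinations, since only finitely many orbits
  have to be told apart.\<close>

type_synonym orbit_structure = "nat list \<Rightarrow> nat list \<Rightarrow> bool"

text \<open>The relation \<open>E xs ys\<close> is to be thought of as "\<open>xs\<close> and \<open>ys\<close> are in the same orbit".
  Equality is not part of the structure, so that quotients need not be formed: it is recovered
  as \<open>E [x, x] [x, y]\<close>.\<close>

definition points :: "orbit_structure \<Rightarrow> nat set" where
  "points E = {x. E [x] [x]}"

text \<open>An interpretation is coded by a parameter tuple \<open>z\<close> and a list \<open>n\<close> of pairs \<open>(l, w)\<close>. Each pair
  names the orbit of \<open>map (nth z) w\<close>, cut after its first \<open>l\<close> entries into two tuples. The union of
  these orbits is a partial equivalence relation on tuples; its classes are the points of the
  interpreted structure.\<close>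

definition interp_eq ::
  "orbit_structure \<Rightarrow> nat list \<Rightarrow> (nat \<times> nat list) list \<Rightarrow> nat list \<Rightarrow> nat list \<Rightarrow> bool" where
  "interp_eq E z n x y \<longleftrightarrow> set x \<subseteq> points E \<and> set y \<subseteq> points E \<and>
     (\<exists>(l, w) \<in> set n. length x = l \<and> set w \<subseteq> {..<length z} \<and> E (x @ y) (map (nth z) w))"

text \<open>The last condition says that every point stabiliser contains the pointwise stabiliser of
  finitely many classes, so that the action on the classes is a topological embedding.\<close>

definition interp_faithful ::
  "orbit_structure \<Rightarrow> nat list \<Rightarrow> (nat \<times> nat list) list \<Rightarrow> bool" where
  "interp_faithful E z n \<longleftrightarrow>
     (\<forall>x y. interp_eq E z n x y \<longrightarrow> interp_eq E z n y x) \<and>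
     (\<forall>x y v. interp_eq E z n x y \<longrightarrow> interp_eq E z n y v \<longrightarrow> interp_eq E z n x v) \<and>
     (\<forall>x\<in>points E. \<exists>bs. (\<forall>b\<in>set bs. interp_eq E z n b b) \<and>
        (\<forall>y\<in>points E. \<forall>cs. list_all2 (interp_eq E z n) bs cs \<longrightarrow> map length cs = map length bs \<longrightarrow>
           E (x # concat bs) (y # concat cs) \<longrightarrow> E [x, x] [x, y]))"

text \<open>Numbers act as codes of tuples, so that an interpreted structure is again an
  \<open>orbit_structure\<close> and interpretations can be nested. For the orbits of a group,
  \<open>ds\<close> is the image of the representatives coded by \<open>us\<close> under one group
  element. The lengths have to be compared because \<open>concat\<close> forgets where a tuple ends,
  while representatives of one class may differ in length.\<close>

definition interp ::
  "orbit_structure \<Rightarrow> nat list \<Rightarrow> (nat \<times> nat list) list \<Rightarrow> orbit_structure" where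
  "interp E z n us vs \<longleftrightarrow>
     (\<forall>u\<in>set us. interp_eq E z n (from_nat u) (from_nat u)) \<and>
     (\<forall>v\<in>set vs. interp_eq E z n (from_nat v) (from_nat v)) \<and>
     (\<exists>ds. map length ds = map length (map (from_nat :: nat \<Rightarrow> nat list) us) \<and>
        E (concat (map from_nat us)) (concat ds) \<and>
        list_all2 (interp_eq E z n) ds (map from_nat vs))"

text \<open>Interpretation is a formula constructor. Hence interpreted structures can be evaluated without
  translating formulas, and the theory of an interpreted structure is read off the theory of
  the original one. Variables are positions in the environment.\<close>

datatype fm =
    Atom "nat list" "nat list"
  | Neg fm
  | Conj fm fm
  | Exists nat fm
  | Faithful "(nat \<times> nat list) list"
  | Interp "(nat \<times> nat list) list" fm

instance fm :: countable by countable_datatype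

text \<open>In the \<open>Interp\<close> case the environment is consumed as the parameter tuple and
  the inner formula starts afresh: only sentences of the interpreted structure are of interest. An
  atom with a position out of range is false, so unspecified values of \<open>nth\<close> never
  enter.\<close>

primrec sat :: "fm \<Rightarrow> orbit_structure \<Rightarrow> nat list \<Rightarrow> bool" where
  "sat (Atom u v) E e \<longleftrightarrow>
     set u \<union> set v \<subseteq> {..<length e} \<and> E (map (nth e) u) (map (nth e) v)"
| "sat (Neg f) E e \<longleftrightarrow> \<not> sat f E e"
| "sat (Conj f g) E e \<longleftrightarrow> sat f E e \<and> sat g E e"
| "sat (Exists m f) E e \<longleftrightarrow> (\<exists>xs. length xs = m \<and> set xs \<subseteq> points E \<and> sat f E (e @ xs))"
| "sat (Faithful n) E e \<longleftrightarrow> interp_faithful E e n"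
| "sat (Interp n f) E e \<longleftrightarrow> sat f (interp E e n) []"

text \<open>Isomorphism of the quotients, phrased without forming them: a point of an interpreted
  structure has many codes, so the correspondence is a relation that need be neither functional nor
  injective.\<close>

definition structure_rel :: "(nat \<Rightarrow> nat \<Rightarrow> bool) \<Rightarrow> orbit_structure \<Rightarrow> orbit_structure \<Rightarrow> bool" where
  "structure_rel R E E' \<longleftrightarrow>
     (\<forall>xs xs' ys ys'. list_all2 R xs xs' \<longrightarrow> list_all2 R ys ys' \<longrightarrow> E xs ys = E' xs' ys') \<and>
     (\<forall>x\<in>points E. \<exists>x'\<in>points E'. R x x') \<and> (\<forall>x'\<in>points E'. \<exists>x\<in>points E. R x x')"

section \<open>Invariance of satisfaction under correspondences of structures\<close>

lemma list_all2_flip: "list_all2 (\<lambda>x y. R y x) xs ys = list_all2 R ys xs"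
  by (simp add: list_all2_conv_all_nth) metis

lemma list_all2_cong_rel:
  assumes "\<And>x x' y y'. S x x' \<Longrightarrow> T y y' \<Longrightarrow> P x y = P' x' y'"
    and "list_all2 S xs xs'" and "list_all2 T ys ys'"
  shows "list_all2 P xs ys = list_all2 P' xs' ys'"
  using assms unfolding list_all2_conv_all_nth by metis

lemma ball_set_cong_rel:
  assumes "\<And>x x'. S x x' \<Longrightarrow> P x = P' x'" and "list_all2 S xs xs'"
  shows "(\<forall>x\<in>set xs. P x) = (\<forall>x\<in>set xs'. P' x)"
  using assms unfolding list_all2_conv_all_nth all_set_conv_all_nth by metis

lemma structure_relD:
  "structure_rel R E E' \<Longrightarrow> list_all2 R xs xs' \<Longrightarrow> list_all2 R ys ys' \<Longrightarrow> E xs ys = E' xs' ys'"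
  unfolding structure_rel_def by blast

lemma structure_rel_sym:
  assumes "structure_rel R E E'"
  shows "structure_rel (\<lambda>x y. R y x) E' E"
  using assms unfolding structure_rel_def list_all2_flip[of R] by metis

lemma structure_rel_points:
  assumes "structure_rel R E E'" and "R x x'"
  shows "x \<in> points E \<longleftrightarrow> x' \<in> points E'"
  using structure_relD[OF assms(1), of "[x]" "[x']" "[x]" "[x']"] assms(2) by (simp add: points_def)

lemma structure_rel_points_list:
  assumes "structure_rel R E E'" and "list_all2 R xs xs'"
  shows "set xs \<subseteq> points E \<longleftrightarrow> set xs' \<subseteq> points E'"
  using assms(2)
  by (induction rule: list_all2_induct) (auto simp: structure_rel_points[OF assms(1)])

lemma structure_rel_lift:
  assumes "structure_rel R E E'" and "set xs \<subseteq> points E"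
  obtains xs' where "list_all2 R xs xs'"
proof -
  have "\<exists>xs'. list_all2 R xs xs'"
    using assms(2)
  proof (induction xs)
    case Nil
    show ?case by (rule exI[of _ "[]"]) simp
  next
    case (Cons x xs)
    then obtain x' xs' where "R x x'" "list_all2 R xs xs'"
      using assms(1) unfolding structure_rel_def by (metis insert_subset list.simps(15))
    then show ?case by (meson list_all2_Cons)
  qed
  with that show thesis by blast
qed

lemma structure_rel_lift_lists:
  assumes "structure_rel R E E'" and "\<forall>b\<in>set bs. set b \<subseteq> points E"
  obtains bs' where "list_all2 (list_all2 R) bs bs'"
proof -
  have "\<exists>bs'. list_all2 (list_all2 R) bs bs'"
    using assms(2)
  proof (induction bs)
    case Nil
    show ?case by (rule exI[of _ "[]"]) simp
  next
    case (Cons b bs)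
    obtain b' where "list_all2 R b b'"
      using structure_rel_lift[OF assms(1), of b] Cons.prems by auto
    moreover obtain bs' where "list_all2 (list_all2 R) bs bs'"
      using Cons by auto
    ultimately show ?case by (meson list_all2_Cons)
  qed
  with that show thesis by blast
qed

lemma list_all2_concat: "list_all2 (list_all2 R) bs bs' \<Longrightarrow> list_all2 R (concat bs) (concat bs')"
  by (induction rule: list_all2_induct) (auto intro: list_all2_appendI)

lemma list_all2_map_length: "list_all2 (list_all2 R) bs bs' \<Longrightarrow> map length bs = map length bs'"
  by (induction rule: list_all2_induct) (auto dest: list_all2_lengthD)

lemma list_all2_select:
  assumes "list_all2 R z z'" and "set w \<subseteq> {..<length z}"
  shows "list_all2 R (map (nth z) w) (map (nth z') w)"
  using assms by (auto simp: list_all2_conv_all_nth subset_iff)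

lemma interp_eq_cong:
  assumes S: "structure_rel R E E'" and z: "list_all2 R z z'"
    and x: "list_all2 R x x'" and y: "list_all2 R y y'"
  shows "interp_eq E z n x y \<longleftrightarrow> interp_eq E' z' n x' y'"
proof -
  have "E (x @ y) (map (nth z) w) = E' (x' @ y') (map (nth z') w)"
    if "set w \<subseteq> {..<length z}" for w
    using structure_relD[OF S list_all2_appendI[OF x y] list_all2_select[OF z that]] .
  then show ?thesis
    unfolding interp_eq_def structure_rel_points_list[OF S x] structure_rel_points_list[OF S y]
      list_all2_lengthD[OF z, symmetric] list_all2_lengthD[OF x, symmetric]
    by (intro conj_cong refl bex_cong) auto
qed

lemma interp_eq_cong_lists:
  assumes S: "structure_rel R E E'" and z: "list_all2 R z z'"
    and x: "list_all2 (list_all2 R) bs bs'" and y: "list_all2 (list_all2 R) cs cs'"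
  shows "list_all2 (interp_eq E z n) bs cs \<longleftrightarrow> list_all2 (interp_eq E' z' n) bs' cs'"
  by (rule list_all2_cong_rel[OF interp_eq_cong[OF S z] x y])

lemma interp_eq_refl_cong:
  assumes "structure_rel R E E'" and "list_all2 R z z'" and "list_all2 (list_all2 R) bs bs'"
  shows "(\<forall>b\<in>set bs. interp_eq E z n b b) \<longleftrightarrow> (\<forall>b\<in>set bs'. interp_eq E' z' n b b)"
  by (rule ball_set_cong_rel[OF _ assms(3)]) (rule interp_eq_cong[OF assms(1,2)])

text \<open>One implication is enough, as the correspondence can be reversed. The witness
  \<open>bs\<close> is carried forward and the challenge \<open>y\<close>, \<open>cs\<close> is
  pulled back. The conclusion transfers because equality is itself the atom
  \<open>E [x, x] [x, y]\<close>.\<close>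

lemma interp_faithful_mono:
  assumes S: "structure_rel R E E'" and z: "list_all2 R z z'" and good: "interp_faithful E z n"
  shows "interp_faithful E' z' n"
proof -
  note S' = structure_rel_sym[OF S]
  have lift: "\<exists>x. list_all2 R x x'" if "interp_eq E' z' n x' y' \<or> interp_eq E' z' n y' x'" for x' y'
  proof -
    have "set x' \<subseteq> points E'"
      using that unfolding interp_eq_def by blast
    from structure_rel_lift[OF S' this] show ?thesis
      unfolding list_all2_flip[of R] by blast
  qed
  have sym: "interp_eq E' z' n y' x'" if "interp_eq E' z' n x' y'" for x' y'
    using lift that good interp_eq_cong[OF S z] unfolding interp_faithful_def by metis
  have trans: "interp_eq E' z' n x' v'" if xy: "interp_eq E' z' n x' y'" and yv: "interp_eq E' z' n y' v'" for x' y' v'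
  proof -
    obtain x y v where "list_all2 R x x'" "list_all2 R y y'" "list_all2 R v v'"
      using lift[of x' y'] lift[of y' v'] lift[of v' y'] xy yv by blast
    then show ?thesis
      using xy yv good interp_eq_cong[OF S z] unfolding interp_faithful_def by metis
  qed
  have "\<exists>bs'. (\<forall>b\<in>set bs'. interp_eq E' z' n b b) \<and>
        (\<forall>y\<in>points E'. \<forall>cs. list_all2 (interp_eq E' z' n) bs' cs \<longrightarrow> map length cs = map length bs' \<longrightarrow>
           E' (x' # concat bs') (y # concat cs) \<longrightarrow> E' [x', x'] [x', y])"
    if x': "x' \<in> points E'" for x'
  proof -
    obtain x where x: "x \<in> points E" "R x x'"
      using S x' unfolding structure_rel_def by blast
    then obtain bs where bs: "\<forall>b\<in>set bs. interp_eq E z n b b" and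
      sep: "\<And>y cs. y \<in> points E \<Longrightarrow> list_all2 (interp_eq E z n) bs cs \<Longrightarrow> map length cs = map length bs \<Longrightarrow>
           E (x # concat bs) (y # concat cs) \<Longrightarrow> E [x, x] [x, y]"
      using good unfolding interp_faithful_def by metis
    obtain bs' where bs': "list_all2 (list_all2 R) bs bs'"
      using structure_rel_lift_lists[OF S, of bs] bs unfolding interp_eq_def by metis
    have "\<forall>b\<in>set bs'. interp_eq E' z' n b b"
      using bs interp_eq_refl_cong[OF S z bs'] by blast
    moreover have "E' [x', x'] [x', y']"
      if y': "y' \<in> points E'" and cs': "list_all2 (interp_eq E' z' n) bs' cs'"
        and len: "map length cs' = map length bs'" and Exy: "E' (x' # concat bs') (y' # concat cs')" for y' cs'
    proof -
      obtain y where y: "y \<in> points E" "R y y'"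
        using S y' unfolding structure_rel_def by blast
      have "\<forall>c\<in>set cs'. set c \<subseteq> points E'"
        using cs' unfolding list_all2_conv_all_nth all_set_conv_all_nth interp_eq_def by auto
      from structure_rel_lift_lists[OF S' this]
      obtain cs where "list_all2 (list_all2 (\<lambda>x y. R y x)) cs' cs" .
      then have cs: "list_all2 (list_all2 R) cs cs'"
        unfolding list_all2_flip[of R] list_all2_flip[of "list_all2 R"] .
      have "list_all2 (interp_eq E z n) bs cs"
        using cs' interp_eq_cong_lists[OF S z bs' cs] by simp
      moreover have "map length cs = map length bs"
        using len list_all2_map_length[OF bs'] list_all2_map_length[OF cs] by simp
      moreover have "E (x # concat bs) (y # concat cs)"
        using Exy structure_relD[OF S, of "x # concat bs" "x' # concat bs'" "y # concat cs" "y' # concat cs'"]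
          x y list_all2_concat[OF bs'] list_all2_concat[OF cs] by simp
      ultimately have "E [x, x] [x, y]"
        using sep y by blast
      then show ?thesis
        using structure_relD[OF S, of "[x, x]" "[x', x']" "[x, y]" "[x', y']"] x y by simp
    qed
    ultimately show ?thesis by blast
  qed
  with sym trans show ?thesis
    unfolding interp_faithful_def by blast
qed

lemma interp_mono:
  assumes S: "structure_rel R E E'" and z: "list_all2 R z z'"
    and us: "list_all2 (\<lambda>u u'. list_all2 R (from_nat u) (from_nat u')) us us'"
    and vs: "list_all2 (\<lambda>u u'. list_all2 R (from_nat u) (from_nat u')) vs vs'"
    and E: "interp E z n us vs"
  shows "interp E' z' n us' vs'"
proof -
  have us: "list_all2 (list_all2 R) (map from_nat us) (map from_nat us')"
    and vs: "list_all2 (list_all2 R) (map from_nat vs) (map from_nat vs')"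
    using us vs by (simp_all add: list_all2_map1 list_all2_map2)
  obtain ds where ds: "map length ds = map length (map (from_nat :: nat \<Rightarrow> nat list) us)"
    "E (concat (map from_nat us)) (concat ds)" "list_all2 (interp_eq E z n) ds (map from_nat vs)"
    using E unfolding interp_def by blast
  have "\<forall>d\<in>set ds. set d \<subseteq> points E"
    using ds(3) unfolding list_all2_conv_all_nth all_set_conv_all_nth interp_eq_def by auto
  then obtain ds' where ds': "list_all2 (list_all2 R) ds ds'"
    using structure_rel_lift_lists[OF S] by blast
  have len: "map length ds' = map length (map (from_nat :: nat \<Rightarrow> nat list) us')"
    using ds(1) list_all2_map_length[OF us] list_all2_map_length[OF ds'] by simp
  have Eds: "E' (concat (map from_nat us')) (concat ds')"
    using ds(2) structure_relD[OF S list_all2_concat[OF us] list_all2_concat[OF ds']] by simp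
  have eqds: "list_all2 (interp_eq E' z' n) ds' (map from_nat vs')"
    using ds(3) interp_eq_cong_lists[OF S z ds' vs] by simp
  have field: "\<forall>u\<in>set ws'. interp_eq E' z' n (from_nat u) (from_nat u)"
    if ws: "list_all2 (list_all2 R) (map from_nat ws) (map from_nat ws')"
      and refl: "\<forall>u\<in>set ws. interp_eq E z n (from_nat u) (from_nat u)" for ws ws'
  proof -
    have "\<forall>b\<in>set (map from_nat ws). interp_eq E z n b b"
      using refl by simp
    then show ?thesis
      unfolding interp_eq_refl_cong[OF S z ws] by simp
  qed
  show ?thesis
    unfolding interp_def
    by (intro conjI exI[of _ ds'] field[OF us] field[OF vs] len Eds eqds) (use E in \<open>auto simp: interp_def\<close>)
qed

lemma points_interp:
  "u \<in> points (interp E z n) \<Longrightarrow> interp_eq E z n (from_nat u) (from_nat u)"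
  unfolding points_def interp_def by simp

lemma structure_rel_interp_half:
  assumes S: "structure_rel R E E'" and z: "list_all2 R z z'" and u: "u \<in> points (interp E z n)"
  shows "\<exists>u'\<in>points (interp E' z' n). list_all2 R (from_nat u) (from_nat u')"
proof -
  obtain b' where b': "list_all2 R (from_nat u) b'"
    using structure_rel_lift[OF S] points_interp[OF u] unfolding interp_eq_def by blast
  \<comment> \<open>Every tuple has a code, so the lifted tuple itself supplies the required
    point.\<close>
  have rel: "list_all2 (\<lambda>u u'. list_all2 R (from_nat u) (from_nat u')) [u] [to_nat b']"
    using b' by simp
  have "interp E' z' n [to_nat b'] [to_nat b']"
    by (rule interp_mono[OF S z rel rel]) (use u in \<open>simp add: points_def\<close>)
  then show ?thesis
    using b' unfolding points_def by (metis from_nat_to_nat mem_Collect_eq)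
qed

lemma structure_rel_interp:
  assumes S: "structure_rel R E E'" and z: "list_all2 R z z'"
  shows "structure_rel (\<lambda>u u'. list_all2 R (from_nat u) (from_nat u')) (interp E z n) (interp E' z' n)"
proof -
  note S' = structure_rel_sym[OF S]
  have z': "list_all2 (\<lambda>x y. R y x) z' z"
    using z list_all2_flip by metis
  have "interp E z n us vs" if "interp E' z' n us' vs'"
    "list_all2 (\<lambda>u u'. list_all2 R (from_nat u) (from_nat u')) us us'"
    "list_all2 (\<lambda>u u'. list_all2 R (from_nat u) (from_nat u')) vs vs'" for us us' vs vs'
    using interp_mono[OF S' z' _ _ that(1), of us vs] that(2,3)
    unfolding list_all2_flip[of R] list_all2_flip[of "\<lambda>u u'. list_all2 R (from_nat u) (from_nat u')"] by blast
  moreover have "\<exists>u\<in>points (interp E z n). list_all2 R (from_nat u) (from_nat u')"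
    if "u' \<in> points (interp E' z' n)" for u'
    using structure_rel_interp_half[OF S' z' that] unfolding list_all2_flip[of R] .
  ultimately show ?thesis
    unfolding structure_rel_def
    by (intro conjI allI impI ballI iffI)
      (auto intro: interp_mono[OF S z] structure_rel_interp_half[OF S z])
qed

text \<open>The induction must leave \<open>R\<close> and both structures arbitrary: under
  \<open>Interp\<close> the points become codes of tuples, and the correspondence becomes entrywise
  \<open>R\<close> between the decoded tuples.\<close>

lemma sat_cong:
  assumes "structure_rel R E E'" and "list_all2 R e e'"
  shows "sat f E e \<longleftrightarrow> sat f E' e'"
  using assms
proof (induction f arbitrary: R E E' e e')
  case (Atom u v)
  show ?case
  proof (cases "set u \<union> set v \<subseteq> {..<length e}")
    case True
    then show ?thesis
      using structure_relD[OF Atom(1), of "map (nth e) u" "map (nth e') u" "map (nth e) v" "map (nth e') v"]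
        list_all2_select[OF Atom(2)] list_all2_lengthD[OF Atom(2)] by simp
  next
    case False
    then show ?thesis
      using list_all2_lengthD[OF Atom(2)] by auto
  qed
next
  case (Neg f)
  then show ?case by (metis sat.simps(2))
next
  case (Conj f g)
  show ?case
    using Conj.IH(1)[OF Conj.prems] Conj.IH(2)[OF Conj.prems] by simp
next
  case (Exists m f)
  have half: "sat (Exists m f) E' e'"
    if S: "structure_rel R E E'" "list_all2 R e e'" and sat: "sat (Exists m f) E e"
      and IH: "\<And>xs xs'. list_all2 R (e @ xs) (e' @ xs') \<Longrightarrow> sat f E (e @ xs) = sat f E' (e' @ xs')"
    for R E E' e e'
  proof -
    obtain xs where xs: "length xs = m" "set xs \<subseteq> points E" "sat f E (e @ xs)"
      using sat by auto
    obtain xs' where xs': "list_all2 R xs xs'"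
      using structure_rel_lift[OF S(1) xs(2)] by blast
    have "sat f E' (e' @ xs')"
      using IH[OF list_all2_appendI[OF S(2) xs']] xs(3) by simp
    then show ?thesis
      using xs structure_rel_points_list[OF S(1) xs'] list_all2_lengthD[OF xs'] by auto
  qed
  note S = Exists.prems(1) and S' = structure_rel_sym[OF Exists.prems(1)]
  have e': "list_all2 (\<lambda>x y. R y x) e' e"
    using Exists.prems(2) unfolding list_all2_flip[of R] .
  show ?case
    using half[OF Exists.prems _ Exists.IH[OF S]] half[OF S' e' _ Exists.IH[OF S']] by blast
next
  case (Faithful n)
  have "list_all2 (\<lambda>x y. R y x) e' e"
    using Faithful(2) list_all2_flip by metis
  then show ?case
    using interp_faithful_mono[OF Faithful] interp_faithful_mono[OF structure_rel_sym[OF Faithful(1)]]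
    by (metis sat.simps(5))
next
  case (Interp n f)
  show ?case
    using Interp.IH[OF structure_rel_interp[OF Interp.prems], of "[]" "[]"] by simp
qed

subsection \<open>Closed permutation groups\<close>

lemma open_cylinder:
  fixes k :: "nat \<Rightarrow> nat"
  assumes "finite B"
  shows "open {h. \<forall>x\<in>B. h x = k x}"
proof -
  have "open {h. h x = k x}" for x
  proof -
    have "open ((\<lambda>h :: nat \<Rightarrow> nat. h x) -` {k x})"
      by (rule open_vimage[OF open_discrete continuous_on_product_coordinates])
    then show ?thesis by (simp add: vimage_def)
  qed
  moreover have "{h. \<forall>x\<in>B. h x = k x} = (\<Inter>x\<in>B. {h. h x = k x})"
    by auto
  ultimately show ?thesis
    using assms by auto
qed

lemma open_contains_cylinder:
  fixes k :: "nat \<Rightarrow> nat"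
  assumes "open U" and "k \<in> U"
  obtains B where "finite B" and "\<And>h. (\<And>x. x \<in> B \<Longrightarrow> h x = k x) \<Longrightarrow> h \<in> U"
proof -
  have "openin (product_topology (\<lambda>i. euclidean) UNIV) U"
    using assms(1) by (simp add: open_fun_def)
  from product_topology_open_contains_basis[OF this assms(2)]
  obtain X where X: "k \<in> (\<Pi>\<^sub>E i\<in>UNIV. X i)" "finite {i. X i \<noteq> topspace euclidean}"
    "(\<Pi>\<^sub>E i\<in>UNIV. X i) \<subseteq> U"
    by blast
  have "h \<in> U" if "\<And>x. x \<in> {i. X i \<noteq> topspace euclidean} \<Longrightarrow> h x = k x" for h
  proof -
    have "h i \<in> X i" for i
    proof (cases "X i = topspace euclidean")
      case False
      then have "h i = k i" using that by simp
      then show ?thesis using X(1) by (simp add: PiE_UNIV_domain Pi_iff)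
    qed simp
    then have "h \<in> (\<Pi>\<^sub>E i\<in>UNIV. X i)"
      by (simp add: PiE_UNIV_domain)
    then show ?thesis using X(3) by blast
  qed
  then show thesis using that X(2) by blast
qed

lemma carrier_Sinf: "carrier Sinf = {g. bij g}"
  by (auto simp: BijGroup_def Bij_def)

lemma mult_Sinf: "bij g \<Longrightarrow> bij h \<Longrightarrow> g \<otimes>\<^bsub>Sinf\<^esub> h = g \<circ> h"
  by (auto simp: BijGroup_def Bij_def compose_def)

lemma one_Sinf: "\<one>\<^bsub>Sinf\<^esub> = id"
  by (auto simp: BijGroup_def)

lemma inv_Sinf: "bij g \<Longrightarrow> inv\<^bsub>Sinf\<^esub> g = inv_into UNIV g"
  by (subst inv_BijGroup) (auto simp: Bij_def)

text \<open>Closed refers to the space of permutations and not to Baire space. Hence the limit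
  \<open>k\<close> is assumed bijective, and a limit that is constructed later needs its own proof
  of surjectivity.\<close>

lemma closedin_Sinf_top_iff:
  "closedin Sinf_top G \<longleftrightarrow> (\<forall>g\<in>G. bij g) \<and>
     (\<forall>k. bij k \<longrightarrow> (\<forall>B. finite B \<longrightarrow> (\<exists>g\<in>G. \<forall>x\<in>B. g x = k x)) \<longrightarrow> k \<in> G)"
  (is "_ \<longleftrightarrow> ?sub \<and> ?lim")
proof -
  have open_iff: "openin Sinf_top (carrier Sinf - G) \<longleftrightarrow> ?lim" if ?sub
  proof
    assume "openin Sinf_top (carrier Sinf - G)"
    then obtain U where U: "open U" "carrier Sinf - G = carrier Sinf \<inter> U"
      by (auto simp: openin_open)
    show ?lim
    proof (intro allI impI, rule ccontr)
      fix k assume k: "bij k" "\<forall>B. finite B \<longrightarrow> (\<exists>g\<in>G. \<forall>x\<in>B. g x = k x)" "k \<notin> G"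
      then have "k \<in> U" using U(2) by (auto simp: carrier_Sinf)
      from open_contains_cylinder[OF U(1) this] obtain B
        where B: "finite B" "\<And>h. (\<And>x. x \<in> B \<Longrightarrow> h x = k x) \<Longrightarrow> h \<in> U" by blast
      then obtain g where "g \<in> G" "g \<in> U" using k(2) by metis
      then show False using U(2) that by (auto simp: carrier_Sinf)
    qed
  next
    assume lim: ?lim
    show "openin Sinf_top (carrier Sinf - G)"
    proof (subst openin_subopen, intro ballI)
      fix k assume "k \<in> carrier Sinf - G"
      then obtain B where B: "finite B" "\<And>g. g \<in> G \<Longrightarrow> \<not> (\<forall>x\<in>B. g x = k x)"
        using lim by (metis Diff_iff carrier_Sinf mem_Collect_eq)
      let ?T = "carrier Sinf \<inter> {h. \<forall>x\<in>B. h x = k x}"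
      have "openin Sinf_top ?T"
        using open_cylinder[OF B(1)] by (auto simp: openin_open)
      moreover have "k \<in> ?T" "?T \<subseteq> carrier Sinf - G"
        using \<open>k \<in> _\<close> B(2) by auto
      ultimately show "\<exists>T. openin Sinf_top T \<and> k \<in> T \<and> T \<subseteq> carrier Sinf - G" by blast
    qed
  qed
  show ?thesis
  proof (cases ?sub)
    case True
    then have "G \<subseteq> carrier Sinf" by (auto simp: carrier_Sinf)
    then show ?thesis
      using open_iff[OF True] True unfolding closedin_def topspace_euclidean_subtopology by satx
  next
    case False
    then have "\<not> G \<subseteq> carrier Sinf" by (auto simp: carrier_Sinf)
    then show ?thesis
      using False unfolding closedin_def topspace_euclidean_subtopology by satx
  qed
qed

lemma closed_subgroup_iff:
  "closed_subgroup G \<longleftrightarrow> (\<forall>g\<in>G. bij g) \<and> id \<in> G \<and> (\<forall>g\<in>G. \<forall>h\<in>G. g \<circ> h \<in> G) \<and> (\<forall>g\<in>G. inv_into UNIV g \<in> G) \<and>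
     (\<forall>k. bij k \<longrightarrow> (\<forall>B. finite B \<longrightarrow> (\<exists>g\<in>G. \<forall>x\<in>B. g x = k x)) \<longrightarrow> k \<in> G)"
proof -
  have "subgroup G Sinf \<longleftrightarrow> (\<forall>g\<in>G. bij g) \<and> id \<in> G \<and> (\<forall>g\<in>G. \<forall>h\<in>G. g \<circ> h \<in> G) \<and> (\<forall>g\<in>G. inv_into UNIV g \<in> G)"
  proof (cases "\<forall>g\<in>G. bij g")
    case True
    then show ?thesis
      unfolding subgroup_def one_Sinf carrier_Sinf by (auto simp: mult_Sinf inv_Sinf)
  next
    case False
    then show ?thesis unfolding subgroup_def carrier_Sinf by blast
  qed
  then show ?thesis
    unfolding closed_subgroup_def closedin_Sinf_top_iff by satx
qed

lemma
  assumes "closed_subgroup G"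
  shows closed_subgroup_bij: "g \<in> G \<Longrightarrow> bij g"
    and closed_subgroup_id: "id \<in> G"
    and closed_subgroup_comp: "g \<in> G \<Longrightarrow> h \<in> G \<Longrightarrow> g \<circ> h \<in> G"
    and closed_subgroup_inv: "g \<in> G \<Longrightarrow> inv_into UNIV g \<in> G"
    and closed_subgroup_limit:
      "bij k \<Longrightarrow> (\<And>B. finite B \<Longrightarrow> \<exists>g\<in>G. \<forall>x\<in>B. g x = k x) \<Longrightarrow> k \<in> G"
proof -
  note facts = assms[unfolded closed_subgroup_iff]
  show "g \<in> G \<Longrightarrow> bij g" "id \<in> G" "g \<in> G \<Longrightarrow> h \<in> G \<Longrightarrow> g \<circ> h \<in> G" "g \<in> G \<Longrightarrow> inv_into UNIV g \<in> G"
    using facts by simp_all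
  show "bij k \<Longrightarrow> (\<And>B. finite B \<Longrightarrow> \<exists>g\<in>G. \<forall>x\<in>B. g x = k x) \<Longrightarrow> k \<in> G"
    using facts[THEN conjunct2, THEN conjunct2, THEN conjunct2, THEN conjunct2] by simp
qed

lemma
  assumes "closed_subgroup G" and "g \<in> G"
  shows closed_subgroup_inv_f: "inv_into UNIV g (g x) = x"
    and closed_subgroup_f_inv: "g (inv_into UNIV g x) = x"
    and closed_subgroup_inv_comp: "inv_into UNIV g \<circ> g = id"
    and closed_subgroup_comp_inv: "g \<circ> inv_into UNIV g = id"
  using closed_subgroup_bij[OF assms]
  by (auto simp: bij_is_inj bij_is_surj surj_f_inv_f fun_eq_iff)

section \<open>Continuous homomorphisms, tested at the identity\<close>

lemma hom_id:
  assumes G: "closed_subgroup G" and H: "closed_subgroup H" and "\<phi> ` G \<subseteq> H"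
    and hom: "\<forall>g\<in>G. \<forall>h\<in>G. \<phi> (g \<circ> h) = \<phi> g \<circ> \<phi> h"
  shows "\<phi> id = id"
proof -
  have "\<phi> id \<in> H"
    using assms(3) closed_subgroup_id[OF G] by blast
  then have inj: "inj (\<phi> id)"
    using closed_subgroup_bij[OF H] bij_is_inj by blast
  have "\<phi> id = \<phi> id \<circ> \<phi> id"
    using hom[rule_format, of id id] closed_subgroup_id[OF G] by simp
  then have "\<phi> id (\<phi> id x) = \<phi> id x" for x
    by (metis comp_apply)
  then show ?thesis
    using injD[OF inj] by (intro ext) simp
qed

text \<open>Pointwise stabilisers of finite sets form a neighbourhood base at the identity, and a
  homomorphism is continuous as soon as it is continuous there.\<close>

lemma continuous_hom_iff:
  assumes G: "closed_subgroup G" and H: "closed_subgroup H" and im: "\<phi> ` G \<subseteq> H"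
    and hom: "\<forall>g\<in>G. \<forall>h\<in>G. \<phi> (g \<circ> h) = \<phi> g \<circ> \<phi> h"
  shows "continuous_map (top_of_set G) (top_of_set H) \<phi> \<longleftrightarrow>
    (\<forall>x. \<exists>B. finite B \<and> (\<forall>g\<in>G. (\<forall>i\<in>B. g i = i) \<longrightarrow> \<phi> g x = x))"
proof -
  have "continuous_on G \<phi> \<longleftrightarrow> (\<forall>x. \<exists>B. finite B \<and> (\<forall>g\<in>G. (\<forall>i\<in>B. g i = i) \<longrightarrow> \<phi> g x = x))"
  proof (intro iffI allI)
    fix x assume cont: "continuous_on G \<phi>"
    define U where "U = {h :: nat \<Rightarrow> nat. \<forall>y\<in>{x}. h y = id y}"
    have U: "open U"
      unfolding U_def by (rule open_cylinder) simp
    have "\<phi> id \<in> U"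
      unfolding U_def hom_id[OF G H im hom] by simp
    then have "\<exists>A. open A \<and> id \<in> A \<and> (\<forall>y\<in>G. y \<in> A \<longrightarrow> \<phi> y \<in> U)"
      by (rule cont[unfolded continuous_on_topological, THEN bspec, OF closed_subgroup_id[OF G],
          THEN spec, THEN mp, OF U, THEN mp])
    then obtain A where A: "open A" "id \<in> A" "\<forall>g\<in>G. g \<in> A \<longrightarrow> \<phi> g \<in> U"
      by (elim exE conjE)
    from open_contains_cylinder[OF A(1,2)] obtain B
      where B: "finite B" "\<And>h. (\<And>x. x \<in> B \<Longrightarrow> h x = id x) \<Longrightarrow> h \<in> A" by blast
    have "\<phi> g x = x" if "g \<in> G" "\<forall>i\<in>B. g i = i" for g
    proof -
      have "g \<in> A"
        by (rule B(2)) (use that(2) in simp)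
      then show ?thesis
        using A(3) that(1) unfolding U_def by simp
    qed
    with B(1) show "\<exists>B. finite B \<and> (\<forall>g\<in>G. (\<forall>i\<in>B. g i = i) \<longrightarrow> \<phi> g x = x)"
      by blast
  next
    assume *: "\<forall>x. \<exists>B. finite B \<and> (\<forall>g\<in>G. (\<forall>i\<in>B. g i = i) \<longrightarrow> \<phi> g x = x)"
    then obtain B where B: "\<And>x. finite (B x)" "\<And>x g. g \<in> G \<Longrightarrow> (\<forall>i\<in>B x. g i = i) \<Longrightarrow> \<phi> g x = x"
      by metis
    show "continuous_on G \<phi>"
      unfolding continuous_on_topological
    proof (intro ballI allI impI)
      fix g U assume g: "g \<in> G" and U: "open U" "\<phi> g \<in> U"
      from open_contains_cylinder[OF U] obtain C
        where C: "finite C" "\<And>h. (\<And>x. x \<in> C \<Longrightarrow> h x = \<phi> g x) \<Longrightarrow> h \<in> U" by blast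
      let ?A = "{h. \<forall>i\<in>(\<Union>x\<in>C. B x). h i = g i}"
      have "\<phi> h \<in> U" if h: "h \<in> G" "h \<in> ?A" for h
      proof (rule C(2))
        fix x assume "x \<in> C"
        \<comment> \<open>Translation to the identity: this element fixes every point of
          \<open>B x\<close>, because \<open>h\<close> and \<open>g\<close> agree there.\<close>
        have k: "inv_into UNIV g \<circ> h \<in> G"
          using G g h closed_subgroup_comp closed_subgroup_inv by blast
        have "\<phi> (inv_into UNIV g \<circ> h) x = x"
          by (rule B(2)[OF k]) (use h \<open>x \<in> C\<close> in \<open>auto simp: closed_subgroup_inv_f[OF G g]\<close>)
        moreover have "g \<circ> (inv_into UNIV g \<circ> h) = h"
          by (auto simp: closed_subgroup_f_inv[OF G g])
        ultimately show "\<phi> h x = \<phi> g x"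
          using hom[rule_format, OF g k] by (metis comp_apply)
      qed
      moreover have "open ?A"
        by (rule open_cylinder) (use C(1) B(1) in auto)
      ultimately show "\<exists>A. open A \<and> g \<in> A \<and> (\<forall>y\<in>G. y \<in> A \<longrightarrow> \<phi> y \<in> U)"
        by (intro exI[of _ ?A]) auto
    qed
  qed
  then show ?thesis
    using im by (simp add: continuous_map_in_subtopology image_subset_iff Pi_iff)
qed

text \<open>The last two conditions are continuity of \<open>\<phi>\<close> and of its inverse; the
  inverse is eliminated by substituting \<open>\<phi> g\<close> for the elements of
  \<open>H\<close>.\<close>

definition topological_iso ::
  "(nat \<Rightarrow> nat) set \<Rightarrow> (nat \<Rightarrow> nat) set \<Rightarrow> ((nat \<Rightarrow> nat) \<Rightarrow> (nat \<Rightarrow> nat)) \<Rightarrow> bool" where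
  "topological_iso G H \<phi> \<longleftrightarrow> bij_betw \<phi> G H \<and>
    (\<forall>g\<in>G. \<forall>h\<in>G. \<phi> (g \<circ> h) = \<phi> g \<circ> \<phi> h) \<and>
    (\<forall>x. \<exists>B. finite B \<and> (\<forall>g\<in>G. (\<forall>i\<in>B. g i = i) \<longrightarrow> \<phi> g x = x)) \<and>
    (\<forall>x. \<exists>B. finite B \<and> (\<forall>g\<in>G. (\<forall>i\<in>B. \<phi> g i = i) \<longrightarrow> g x = x))"

lemma topologically_isomorphic_iff:
  assumes G: "closed_subgroup G" and H: "closed_subgroup H"
  shows "topologically_isomorphic G H \<longleftrightarrow> (\<exists>\<phi>. topological_iso G H \<phi>)"
proof -
  have top: "subtopology Sinf_top K = top_of_set K" if "closed_subgroup K" for K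
  proof -
    have "carrier Sinf \<inter> K = K"
      using that closed_subgroup_bij by (auto simp: carrier_Sinf)
    then show ?thesis by (simp add: subtopology_subtopology)
  qed
  have iso: "\<phi> \<in> iso (Sinf\<lparr>carrier := G\<rparr>) (Sinf\<lparr>carrier := H\<rparr>) \<longleftrightarrow>
      bij_betw \<phi> G H \<and> (\<forall>g\<in>G. \<forall>h\<in>G. \<phi> (g \<circ> h) = \<phi> g \<circ> \<phi> h)" for \<phi>
  proof (cases "bij_betw \<phi> G H")
    case True
    then have im: "\<phi> g \<in> H" if "g \<in> G" for g
      using that bij_betwE by blast
    show ?thesis
      using True im closed_subgroup_bij[OF G] closed_subgroup_bij[OF H]
      by (simp add: iso_def hom_def mult_Sinf Pi_iff)
  next
    case False
    then show ?thesis by (simp add: iso_def)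
  qed
  have homeo: "homeomorphic_map (top_of_set G) (top_of_set H) \<phi> \<longleftrightarrow>
      (\<forall>x. \<exists>B. finite B \<and> (\<forall>g\<in>G. (\<forall>i\<in>B. g i = i) \<longrightarrow> \<phi> g x = x)) \<and>
      (\<forall>x. \<exists>B. finite B \<and> (\<forall>g\<in>G. (\<forall>i\<in>B. \<phi> g i = i) \<longrightarrow> g x = x))"
    if bij: "bij_betw \<phi> G H" and hom: "\<forall>g\<in>G. \<forall>h\<in>G. \<phi> (g \<circ> h) = \<phi> g \<circ> \<phi> h" for \<phi>
  proof -
    define \<psi> where "\<psi> = inv_into G \<phi>"
    have im: "\<phi> ` G = H" and inj: "inj_on \<phi> G"
      using bij by (auto simp: bij_betw_def)
    have \<psi>: "\<psi> h \<in> G" "\<phi> (\<psi> h) = h" if "h \<in> H" for h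
      using that unfolding \<psi>_def im[symmetric] by (simp_all add: inv_into_into f_inv_into_f)
    have \<psi>': "\<psi> (\<phi> g) = g" if "g \<in> G" for g
      using that inj unfolding \<psi>_def by simp
    have \<psi>hom: "\<psi> (g \<circ> h) = \<psi> g \<circ> \<psi> h" if "g \<in> H" "h \<in> H" for g h
    proof -
      have "\<phi> (\<psi> g \<circ> \<psi> h) = g \<circ> h" using hom \<psi> that by simp
      then show ?thesis using \<psi>'[of "\<psi> g \<circ> \<psi> h"] \<psi> that closed_subgroup_comp[OF G] by simp
    qed
    have "homeomorphic_map (top_of_set G) (top_of_set H) \<phi> \<longleftrightarrow>
        homeomorphic_maps (top_of_set G) (top_of_set H) \<phi> \<psi>"
    proof
      assume "homeomorphic_map (top_of_set G) (top_of_set H) \<phi>"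
      then obtain \<theta> where \<theta>: "homeomorphic_maps (top_of_set G) (top_of_set H) \<phi> \<theta>"
        unfolding homeomorphic_map_maps by blast
      have "\<theta> h = \<psi> h" if "h \<in> H" for h
        using \<theta> \<psi>[OF that] unfolding homeomorphic_maps_def by auto
      then show "homeomorphic_maps (top_of_set G) (top_of_set H) \<phi> \<psi>"
        using homeomorphic_maps_eq[OF \<theta>, of \<phi> \<psi>] by simp
    qed (auto simp: homeomorphic_map_maps)
    also have "\<dots> \<longleftrightarrow> continuous_map (top_of_set G) (top_of_set H) \<phi> \<and>
        continuous_map (top_of_set H) (top_of_set G) \<psi>"
      unfolding homeomorphic_maps_def using \<psi> \<psi>' by auto
    also have "\<dots> \<longleftrightarrow> (\<forall>x. \<exists>B. finite B \<and> (\<forall>g\<in>G. (\<forall>i\<in>B. g i = i) \<longrightarrow> \<phi> g x = x)) \<and>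
        (\<forall>x. \<exists>B. finite B \<and> (\<forall>h\<in>H. (\<forall>i\<in>B. h i = i) \<longrightarrow> \<psi> h x = x))"
      using continuous_hom_iff[OF G H, of \<phi>] continuous_hom_iff[OF H G, of \<psi>] im hom \<psi>hom \<psi>(1)
      by (auto simp: image_subset_iff)
    also have "(\<forall>x. \<exists>B. finite B \<and> (\<forall>h\<in>H. (\<forall>i\<in>B. h i = i) \<longrightarrow> \<psi> h x = x)) \<longleftrightarrow>
        (\<forall>x. \<exists>B. finite B \<and> (\<forall>g\<in>G. (\<forall>i\<in>B. \<phi> g i = i) \<longrightarrow> g x = x))"
      unfolding im[symmetric] using \<psi>' by simp
    finally show ?thesis .
  qed
  show ?thesis
    unfolding topologically_isomorphic_def topological_iso_def top[OF G] top[OF H] iso conj_assoc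
    by (rule ex_cong1, rule conj_cong[OF refl], rule conj_cong[OF refl], rule homeo)
qed

lemma topologically_isomorphic_sym:
  assumes G: "closed_subgroup G" and H: "closed_subgroup H" and "topologically_isomorphic G H"
  shows "topologically_isomorphic H G"
proof -
  obtain \<phi> where "topological_iso G H \<phi>"
    using assms(3) topologically_isomorphic_iff[OF G H] by blast
  then have bij: "bij_betw \<phi> G H"
    and hom: "\<forall>g\<in>G. \<forall>h\<in>G. \<phi> (g \<circ> h) = \<phi> g \<circ> \<phi> h"
    and cont: "\<forall>x. \<exists>B. finite B \<and> (\<forall>g\<in>G. (\<forall>i\<in>B. g i = i) \<longrightarrow> \<phi> g x = x)"
      "\<forall>x. \<exists>B. finite B \<and> (\<forall>g\<in>G. (\<forall>i\<in>B. \<phi> g i = i) \<longrightarrow> g x = x)"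
    unfolding topological_iso_def by simp_all
  define \<psi> where "\<psi> = inv_into G \<phi>"
  have im: "\<phi> ` G = H" and \<psi>': "\<And>g. g \<in> G \<Longrightarrow> \<psi> (\<phi> g) = g"
    using bij by (auto simp: bij_betw_def \<psi>_def)
  have "bij_betw \<psi> H G"
    using bij unfolding \<psi>_def by (rule bij_betw_inv_into)
  moreover have "\<forall>g\<in>H. \<forall>h\<in>H. \<psi> (g \<circ> h) = \<psi> g \<circ> \<psi> h"
  proof (intro ballI)
    fix g h assume "g \<in> H" "h \<in> H"
    then obtain a b where "a \<in> G" "b \<in> G" "g = \<phi> a" "h = \<phi> b"
      unfolding im[symmetric] by blast
    then show "\<psi> (g \<circ> h) = \<psi> g \<circ> \<psi> h"
      using hom[rule_format, of a b] \<psi>'[of "a \<circ> b"] \<psi>'[of a] \<psi>'[of b] closed_subgroup_comp[OF G, of a b] by simp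
  qed
  moreover have "\<forall>x. \<exists>B. finite B \<and> (\<forall>h\<in>H. (\<forall>i\<in>B. h i = i) \<longrightarrow> \<psi> h x = x)"
    "\<forall>x. \<exists>B. finite B \<and> (\<forall>h\<in>H. (\<forall>i\<in>B. \<psi> h i = i) \<longrightarrow> h x = x)"
    using cont \<psi>' unfolding im[symmetric] by simp_all
  ultimately have "topological_iso H G \<psi>"
    unfolding topological_iso_def by simp
  then show ?thesis
    using topologically_isomorphic_iff[OF H G] by blast
qed

lemma topologically_isomorphic_trans:
  assumes "topologically_isomorphic G H" and "topologically_isomorphic H K"
  shows "topologically_isomorphic G K"
proof -
  obtain \<phi> \<psi> where "\<phi> \<in> iso (Sinf\<lparr>carrier := G\<rparr>) (Sinf\<lparr>carrier := H\<rparr>)"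
    "homeomorphic_map (subtopology Sinf_top G) (subtopology Sinf_top H) \<phi>"
    "\<psi> \<in> iso (Sinf\<lparr>carrier := H\<rparr>) (Sinf\<lparr>carrier := K\<rparr>)"
    "homeomorphic_map (subtopology Sinf_top H) (subtopology Sinf_top K) \<psi>"
    using assms unfolding topologically_isomorphic_def by blast
  then show ?thesis
    unfolding topologically_isomorphic_def
    by (intro exI[of _ "\<psi> \<circ> \<phi>"] conjI iso_set_trans homeomorphic_map_compose)
qed

subsection \<open>Actions on quotients of tuples\<close>

definition same_orbit :: "(nat \<Rightarrow> nat) set \<Rightarrow> nat list \<Rightarrow> nat list \<Rightarrow> bool" where
  "same_orbit G xs ys \<longleftrightarrow> (\<exists>g\<in>G. map g xs = ys)"

lemma same_orbit_sym:
  assumes G: "closed_subgroup G" and "same_orbit G xs ys"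
  shows "same_orbit G ys xs"
proof -
  obtain g where g: "g \<in> G" "ys = map g xs"
    using assms(2) unfolding same_orbit_def by blast
  then have "map (inv_into UNIV g) ys = xs"
    using closed_subgroup_inv_comp[OF G g(1)] by simp
  then show ?thesis
    unfolding same_orbit_def using closed_subgroup_inv[OF G g(1)] by blast
qed

lemma same_orbit_trans:
  assumes G: "closed_subgroup G" and "same_orbit G xs ys" and "same_orbit G ys zs"
  shows "same_orbit G xs zs"
proof -
  obtain g h where "g \<in> G" "ys = map g xs" "h \<in> G" "zs = map h ys"
    using assms(2,3) unfolding same_orbit_def by blast
  then show ?thesis
    unfolding same_orbit_def using closed_subgroup_comp[OF G] by (intro bexI[of _ "h \<circ> g"]) auto
qed

lemma oligomorphic_iff:
  "oligomorphic G \<longleftrightarrow> closed_subgroup G \<and>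
     (\<forall>n. \<exists>R. finite R \<and> (\<forall>xs. length xs = n \<longrightarrow> (\<exists>r\<in>R. same_orbit G r xs)))"
proof (cases "closed_subgroup G")
  case G: True
  define Orb where "Orb n = orbits (Sinf\<lparr>carrier := G\<rparr>) {xs :: nat list. length xs = n} map" for n
  have Orb: "Orb n = {{ys. same_orbit G xs ys} | xs. length xs = n}" for n
    unfolding Orb_def orbits_def orbit_def same_orbit_def by (intro Collect_cong) (auto 4 3)
  have eq: "{ys. same_orbit G xs ys} = {ys. same_orbit G r ys}" if "same_orbit G r xs" for r xs
    using that same_orbit_sym[OF G] same_orbit_trans[OF G] by blast
  have "finite (Orb n) \<longleftrightarrow> (\<exists>R. finite R \<and> (\<forall>xs. length xs = n \<longrightarrow> (\<exists>r\<in>R. same_orbit G r xs)))" for n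
  proof
    assume fin: "finite (Orb n)"
    define R where "R = (\<lambda>C. SOME r. r \<in> C) ` Orb n"
    have "\<exists>r\<in>R. same_orbit G r xs" if "length xs = n" for xs
    proof -
      let ?O = "{ys. same_orbit G xs ys}"
      have "xs \<in> ?O"
        using closed_subgroup_id[OF G] unfolding same_orbit_def by force
      then have "(SOME r. r \<in> ?O) \<in> ?O"
        by (rule someI)
      moreover have "(SOME r. r \<in> ?O) \<in> R"
        unfolding R_def Orb using that by blast
      ultimately show ?thesis
        using same_orbit_sym[OF G] by blast
    qed
    moreover have "finite R"
      unfolding R_def using fin by simp
    ultimately show "\<exists>R. finite R \<and> (\<forall>xs. length xs = n \<longrightarrow> (\<exists>r\<in>R. same_orbit G r xs))"
      by blast
  next
    assume "\<exists>R. finite R \<and> (\<forall>xs. length xs = n \<longrightarrow> (\<exists>r\<in>R. same_orbit G r xs))"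
    then obtain R where R: "finite R" "\<And>xs. length xs = n \<Longrightarrow> \<exists>r\<in>R. same_orbit G r xs"
      by blast
    have "Orb n \<subseteq> (\<lambda>r. {ys. same_orbit G r ys}) ` R"
    proof
      fix O' assume "O' \<in> Orb n"
      then obtain xs where xs: "O' = {ys. same_orbit G xs ys}" "length xs = n"
        unfolding Orb by blast
      then obtain r where "r \<in> R" "same_orbit G r xs"
        using R(2) by blast
      then show "O' \<in> (\<lambda>r. {ys. same_orbit G r ys}) ` R"
        using eq xs(1) by blast
    qed
    then show "finite (Orb n)"
      using R(1) finite_surj by blast
  qed
  \<comment> \<open>The definition speaks of arities at least 1; arity 0, with its single empty
    tuple, is added here.\<close>
  moreover have "finite (Orb 0)"
    unfolding Orb by simp
  ultimately show ?thesis
    unfolding oligomorphic_def Orb_def[symmetric] using G by (metis One_nat_def Suc_leI neq0_conv)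
next
  case False
  then show ?thesis unfolding oligomorphic_def by blast
qed

text \<open>Here \<open>p\<close> names the classes of an invariant equivalence relation on
  \<open>D\<close> by all the natural numbers, so the induced action of \<open>G\<close> is by
  permutations of the natural numbers. Continuity of this action is automatic, a class being fixed
  with the entries of a representative. The assumption \<open>separating\<close> is what makes it
  injective with continuous inverse.\<close>

locale equivariant_quotient =
  fixes G :: "(nat \<Rightarrow> nat) set" and D :: "nat list set" and p :: "nat list \<Rightarrow> nat"
  assumes G: "closed_subgroup G"
    and D_invariant: "b \<in> D \<Longrightarrow> g \<in> G \<Longrightarrow> map g b \<in> D"
    and onto: "p ` D = UNIV"
    and kernel_invariant: "b \<in> D \<Longrightarrow> c \<in> D \<Longrightarrow> g \<in> G \<Longrightarrow> p b = p c \<Longrightarrow> p (map g b) = p (map g c)"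
    and separating: "\<exists>bs. set bs \<subseteq> D \<and> (\<forall>g\<in>G. (\<forall>b\<in>set bs. p (map g b) = p b) \<longrightarrow> g x = x)"
begin

definition section_of :: "nat \<Rightarrow> nat list" where
  "section_of x = (SOME b. b \<in> D \<and> p b = x)"

definition act :: "(nat \<Rightarrow> nat) \<Rightarrow> nat \<Rightarrow> nat" where
  "act g x = p (map g (section_of x))"

lemma section_of: "section_of x \<in> D" "p (section_of x) = x"
proof -
  have "\<exists>b. b \<in> D \<and> p b = x"
    using onto by (metis UNIV_I image_iff)
  then have "section_of x \<in> D \<and> p (section_of x) = x"
    unfolding section_of_def by (rule someI_ex)
  then show "section_of x \<in> D" "p (section_of x) = x" by auto
qed

lemma act_p: "b \<in> D \<Longrightarrow> g \<in> G \<Longrightarrow> act g (p b) = p (map g b)"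
  unfolding act_def by (rule kernel_invariant) (auto simp: section_of)

lemma act_id: "act id = id"
  by (auto simp: act_def section_of)

lemma act_comp:
  assumes "g \<in> G" and "h \<in> G"
  shows "act (g \<circ> h) = act g \<circ> act h"
proof
  fix x
  have "act g (act h x) = p (map g (map h (section_of x)))"
    unfolding act_def[of h] by (rule act_p[OF D_invariant[OF section_of(1) assms(2)] assms(1)])
  then show "act (g \<circ> h) x = (act g \<circ> act h) x"
    by (simp add: act_def)
qed

lemma act_inv: "g \<in> G \<Longrightarrow> act (inv_into UNIV g) (act g x) = x" "g \<in> G \<Longrightarrow> act g (act (inv_into UNIV g) x) = x"
  using act_comp[of "inv_into UNIV g" g] act_comp[of g "inv_into UNIV g"] act_id
    closed_subgroup_inv[OF G] closed_subgroup_inv_comp[OF G] closed_subgroup_comp_inv[OF G]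
  by (metis comp_apply id_apply)+

lemma act_bij: "g \<in> G \<Longrightarrow> bij (act g)"
  using act_inv by (intro o_bij[of "act (inv_into UNIV g)"]) auto

lemma inv_act: "g \<in> G \<Longrightarrow> inv_into UNIV (act g) = act (inv_into UNIV g)"
  using act_inv by (intro inv_equality) auto

lemma finite_base: "\<exists>B. finite B \<and> (\<forall>g\<in>G. (\<forall>i\<in>B. act g i = i) \<longrightarrow> g x = x)"
proof -
  obtain bs where bs: "set bs \<subseteq> D" "\<And>g. g \<in> G \<Longrightarrow> \<forall>b\<in>set bs. p (map g b) = p b \<Longrightarrow> g x = x"
    using separating by metis
  have "g x = x" if "g \<in> G" "\<forall>i\<in>p ` set bs. act g i = i" for g
    by (intro bs(2)[OF that(1)] ballI) (metis act_p bs(1) imageI subsetD that)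
  then show ?thesis
    by (intro exI[of _ "p ` set bs"]) auto
qed

definition base :: "nat \<Rightarrow> nat set" where
  "base x = (SOME B. finite B \<and> (\<forall>g\<in>G. (\<forall>i\<in>B. act g i = i) \<longrightarrow> g x = x))"

lemma base: "finite (base x)" "g \<in> G \<Longrightarrow> (\<forall>i\<in>base x. act g i = i) \<Longrightarrow> g x = x"
  using someI_ex[OF finite_base[of x]] unfolding base_def by auto

text \<open>Finitely many values of \<open>act g\<close> determine \<open>g x\<close>. This is how
  convergence in the image is turned into convergence in \<open>G\<close>.\<close>

lemma base_agree:
  assumes "g \<in> G" and "h \<in> G" and "\<And>i. i \<in> base x \<Longrightarrow> act g i = act h i"
  shows "g x = h x"
proof -
  note inv = closed_subgroup_inv[OF G assms(2)]
  have "(inv_into UNIV h \<circ> g) x = x"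
  proof (rule base(2))
    show "inv_into UNIV h \<circ> g \<in> G"
      by (rule closed_subgroup_comp[OF G inv assms(1)])
    show "\<forall>i\<in>base x. act (inv_into UNIV h \<circ> g) i = i"
      using act_comp[OF inv assms(1)] assms(3) act_inv(1)[OF assms(2)] by simp
  qed
  then show ?thesis
    using closed_subgroup_f_inv[OF G assms(2)] by (metis comp_apply)
qed

lemma act_inj: "inj_on act G"
  by (rule inj_onI, rule ext, rule base_agree) auto

text \<open>When \<open>act g\<close> approximates \<open>h\<close> well enough to agree with it on
  \<open>base x\<close>, the value \<open>g x\<close> is already settled. The settled values define
  \<open>k\<close>, which is injective as a pointwise limit of injections and is then shown to be
  onto and to act as \<open>h\<close>.\<close>

lemma limit_in_image:
  assumes h: "bij h" and lim: "\<And>B. finite B \<Longrightarrow> \<exists>g\<in>G. \<forall>x\<in>B. act g x = h x"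
  shows "h \<in> act ` G"
proof -
  have "\<forall>x. \<exists>g\<in>G. \<forall>i\<in>base x. act g i = h i"
    using lim base(1) by blast
  then obtain a where a: "\<And>x. a x \<in> G" "\<And>x i. i \<in> base x \<Longrightarrow> act (a x) i = h i"
    by metis
  define k where "k x = a x x" for x
  have k: "g x = k x" if "g \<in> G" "\<And>i. i \<in> base x \<Longrightarrow> act g i = h i" for g x
    unfolding k_def by (rule base_agree[OF that(1) a(1)]) (simp add: that(2) a(2))
  have approx: "\<exists>g\<in>G. (\<forall>x\<in>B. g x = k x) \<and> (\<forall>x\<in>C. act g x = h x)" if "finite B" "finite C" for B C
  proof -
    have "finite ((\<Union>x\<in>B. base x) \<union> C)"
      using that base(1) by simp
    from lim[OF this] obtain g where g: "g \<in> G" "\<forall>x\<in>(\<Union>x\<in>B. base x) \<union> C. act g x = h x"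
      by blast
    have "g x = k x" if "x \<in> B" for x
      by (rule k[OF g(1)]) (use g(2) that in blast)
    then show ?thesis
      using g by blast
  qed
  have "inj k"
  proof (rule injI)
    fix x y assume eq: "k x = k y"
    obtain g where g: "g \<in> G" "\<forall>z\<in>{x, y}. g z = k z"
      using approx[of "{x, y}" "{}"] by auto
    then have "g x = g y" using eq by simp
    then show "x = y"
      using closed_subgroup_inv_f[OF G g(1)] by metis
  qed
  moreover have "\<exists>x. k x = y" for y
  proof -
    \<comment> \<open>If \<open>act f\<close> agrees with \<open>h\<close> on \<open>?C\<close>,
      then the inverse of \<open>f\<close> acts on \<open>base y\<close> as the inverse of
      \<open>h\<close>. So all such approximations have the same preimage of \<open>y\<close>, and
      \<open>k\<close> sends it to \<open>y\<close>.\<close>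
    let ?C = "inv_into UNIV h ` base y"
    have C: "finite ?C"
      using base(1) by simp
    obtain g where g: "g \<in> G" "\<forall>x\<in>?C. act g x = h x"
      using lim[OF C] by blast
    define x where "x = inv_into UNIV g y"
    obtain f where f: "f \<in> G" "f x = k x" "\<forall>x\<in>?C. act f x = h x"
      using approx[of "{x}" ?C] C by auto
    have inv: "act (inv_into UNIV f) i = inv_into UNIV h i"
      if "f \<in> G" "\<forall>x\<in>?C. act f x = h x" "i \<in> base y" for f i
    proof -
      have "act f (inv_into UNIV h i) = i"
        using that h by (simp add: bij_is_surj surj_f_inv_f)
      then show ?thesis
        using act_inv(1)[OF that(1)] by metis
    qed
    have "inv_into UNIV f y = inv_into UNIV g y"
      by (rule base_agree[OF closed_subgroup_inv[OF G f(1)] closed_subgroup_inv[OF G g(1)]])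
        (use inv[OF f(1,3)] inv[OF g] in simp)
    then have "k x = y"
      using f closed_subgroup_f_inv[OF G f(1)] x_def by metis
    then show ?thesis ..
  qed
  ultimately have "bij k"
    by (metis bij_betw_def surjI surj_def)
  then have kG: "k \<in> G"
    using closed_subgroup_limit[OF G] approx[of _ "{}"] by blast
  \<comment> \<open>Only the values of \<open>k\<close> on the entries of the finite tuple
    \<open>section_of x\<close> matter.\<close>
  have "act k x = h x" for x
  proof -
    obtain g where g: "g \<in> G" "\<forall>z\<in>set (section_of x). g z = k z" "act g x = h x"
      using approx[of "set (section_of x)" "{x}"] by auto
    then have eq: "map k (section_of x) = map g (section_of x)" by simp
    show ?thesis
      using g(3) unfolding act_def eq .
  qed
  then have "act k = h" by blast
  then show ?thesis using kG by blast
qed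

lemma closed_subgroup_image: "closed_subgroup (act ` G)"
  unfolding closed_subgroup_iff
proof (intro conjI allI impI)
  show "\<forall>g\<in>act ` G. bij g"
    using act_bij by blast
  show "id \<in> act ` G"
    using act_id closed_subgroup_id[OF G] by (metis imageI)
  show "\<forall>g\<in>act ` G. \<forall>h\<in>act ` G. g \<circ> h \<in> act ` G"
  proof (intro ballI)
    fix g h assume "g \<in> act ` G" "h \<in> act ` G"
    then obtain a b where "a \<in> G" "b \<in> G" "g = act a" "h = act b" by blast
    then show "g \<circ> h \<in> act ` G"
      using act_comp closed_subgroup_comp[OF G] by (intro image_eqI[of _ _ "a \<circ> b"]) auto
  qed
  show "\<forall>g\<in>act ` G. inv_into UNIV g \<in> act ` G"
    using inv_act closed_subgroup_inv[OF G] by auto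
  fix k assume "bij k" "\<forall>B. finite B \<longrightarrow> (\<exists>g\<in>act ` G. \<forall>x\<in>B. g x = k x)"
  then show "k \<in> act ` G"
    by (intro limit_in_image) auto
qed

lemma topological_iso_act: "topological_iso G (act ` G) act"
  unfolding topological_iso_def
proof (intro conjI)
  show "bij_betw act G (act ` G)"
    using act_inj by (simp add: bij_betw_def)
  show "\<forall>g\<in>G. \<forall>h\<in>G. act (g \<circ> h) = act g \<circ> act h"
    using act_comp by blast
  have "act g x = x" if "\<forall>i\<in>set (section_of x). g i = i" for g x
  proof -
    have "map g (section_of x) = section_of x"
      using that by (simp add: map_idI)
    then show ?thesis
      by (simp add: act_def section_of)
  qed
  then show "\<forall>x. \<exists>B. finite B \<and> (\<forall>g\<in>G. (\<forall>i\<in>B. g i = i) \<longrightarrow> act g x = x)"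
    by (metis List.finite_set)
  show "\<forall>x. \<exists>B. finite B \<and> (\<forall>g\<in>G. (\<forall>i\<in>B. act g i = i) \<longrightarrow> g x = x)"
    using finite_base by blast
qed

lemma topologically_isomorphic_image: "topologically_isomorphic G (act ` G)"
  using topological_iso_act topologically_isomorphic_iff[OF G closed_subgroup_image] by blast

lemma same_orbit_image_iff:
  assumes "set bs \<subseteq> D"
  shows "same_orbit (act ` G) (map p bs) xs \<longleftrightarrow> (\<exists>g\<in>G. map p (map (map g) bs) = xs)"
proof -
  have "map (act g) (map p bs) = map p (map (map g) bs)" if "g \<in> G" for g
    using assms that act_p by auto
  then show ?thesis
    unfolding same_orbit_def by auto
qed

end

subsection \<open>Types and conjugacy\<close>

lemma same_orbit_refl: "closed_subgroup G \<Longrightarrow> same_orbit G xs xs"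
  unfolding same_orbit_def by (rule bexI[of _ id]) (auto simp: closed_subgroup_id)

lemma points_same_orbit: "closed_subgroup G \<Longrightarrow> points (same_orbit G) = UNIV"
  unfolding points_def by (simp add: same_orbit_refl)

lemma list_all2_graph: "list_all2 (\<lambda>x y. y = g x) xs ys \<longleftrightarrow> ys = map g xs"
  by (auto simp: list_all2_conv_all_nth intro: nth_equalityI)

lemma same_orbit_map_iff:
  assumes G: "closed_subgroup G" and g: "g \<in> G"
  shows "same_orbit G (map g xs) (map g ys) \<longleftrightarrow> same_orbit G xs ys"
proof -
  have "same_orbit G us (map g us)" for us
    unfolding same_orbit_def using g by blast
  then show ?thesis
    using same_orbit_sym[OF G] same_orbit_trans[OF G] by blast
qed

text \<open>The graph of an element of \<open>G\<close> is a correspondence of the orbit structure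
  with itself.\<close>

lemma sat_same_orbit:
  assumes G: "closed_subgroup G" and "same_orbit G e e'"
  shows "sat f (same_orbit G) e \<longleftrightarrow> sat f (same_orbit G) e'"
proof -
  obtain g where g: "g \<in> G" "e' = map g e"
    using assms(2) unfolding same_orbit_def by blast
  have "bij g"
    by (rule closed_subgroup_bij[OF G g(1)])
  have "structure_rel (\<lambda>x y. y = g x) (same_orbit G) (same_orbit G)"
    unfolding structure_rel_def list_all2_graph points_same_orbit[OF G]
    using same_orbit_map_iff[OF G g(1)] bij_pointE[OF \<open>bij g\<close>] by (metis UNIV_I)
  then show ?thesis
    by (rule sat_cong) (simp add: list_all2_graph g(2))
qed

lemma finite_conjunction:
  assumes "finite S"
  obtains f where "\<And>E e. sat f E e \<longleftrightarrow> (\<forall>h\<in>S. sat h E e)"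
proof -
  have "\<exists>f. \<forall>E e. sat f E e \<longleftrightarrow> (\<forall>h\<in>S. sat h E e)"
    using assms
  proof (induction S)
    case empty
    \<comment> \<open>The language has no symbol for truth; this is a tautology serving as the empty
      conjunction.\<close>
    have "sat (Neg (Conj (Faithful []) (Neg (Faithful [])))) E e" for E e
      by simp
    then show ?case by blast
  next
    case (insert h S)
    then obtain f where "\<forall>E e. sat f E e \<longleftrightarrow> (\<forall>h\<in>S. sat h E e)" by blast
    then have "\<forall>E e. sat (Conj h f) E e \<longleftrightarrow> (\<forall>h\<in>insert h S. sat h E e)" by simp
    then show ?case by blast
  qed
  then show thesis using that by blast
qed

text \<open>Among the finitely many orbit representatives of the right length, each one whose type
  differs from that of \<open>e\<close> is refuted by some formula true of \<open>e\<close>; the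
  conjunction of these formulas isolates the type. What is isolated is the type, which may contain
  several orbits.\<close>

lemma type_isolated:
  assumes "oligomorphic G"
  obtains f where "sat f (same_orbit G) e"
    and "\<And>e' h. length e' = length e \<Longrightarrow> sat f (same_orbit G) e' \<Longrightarrow>
      sat h (same_orbit G) e' \<longleftrightarrow> sat h (same_orbit G) e"
proof -
  let ?E = "same_orbit G"
  have G: "closed_subgroup G"
    using assms unfolding oligomorphic_iff by blast
  obtain R where R: "finite R" "\<And>xs. length xs = length e \<Longrightarrow> \<exists>r\<in>R. ?E r xs"
    using assms unfolding oligomorphic_iff by metis
  define bad where "bad = {r \<in> R. \<exists>h. sat h ?E r \<noteq> sat h ?E e}"
  have "\<exists>h. sat h ?E e \<and> \<not> sat h ?E r" if "r \<in> bad" for r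
  proof -
    obtain h where "sat h ?E r \<noteq> sat h ?E e"
      using \<open>r \<in> bad\<close> unfolding bad_def by blast
    then show ?thesis
      by (cases "sat h ?E e") (auto intro: exI[of _ h] exI[of _ "Neg h"])
  qed
  then obtain d where d: "\<And>r. r \<in> bad \<Longrightarrow> sat (d r) ?E e" "\<And>r. r \<in> bad \<Longrightarrow> \<not> sat (d r) ?E r"
    by metis
  have "finite (d ` bad)"
    using R(1) unfolding bad_def by simp
  then obtain f where f: "\<And>E e. sat f E e \<longleftrightarrow> (\<forall>h\<in>d ` bad. sat h E e)"
    using finite_conjunction by blast
  show thesis
  proof
    show "sat f ?E e"
      using f d(1) by blast
    fix e' h assume e': "length e' = length e" "sat f ?E e'"
    then obtain r where r: "r \<in> R" "?E r e'"
      using R(2) by blast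
    have "r \<notin> bad"
      using d(2) e'(2) f sat_same_orbit[OF G r(2)] by blast
    then show "sat h ?E e' \<longleftrightarrow> sat h ?E e"
      using r(1) sat_same_orbit[OF G r(2)] unfolding bad_def by blast
  qed
qed

text \<open>On each finite set an element of one group agrees with an element of the other, and
  closedness does the rest.\<close>

lemma closed_subgroup_eqI:
  assumes G: "closed_subgroup G" and H: "closed_subgroup H" and eq: "same_orbit G = same_orbit H"
  shows "G = H"
proof -
  have "G \<subseteq> H" if G: "closed_subgroup G" and H: "closed_subgroup H" and eq: "same_orbit G = same_orbit H" for G H
  proof
    fix g assume g: "g \<in> G"
    show "g \<in> H"
    proof (rule closed_subgroup_limit[OF H closed_subgroup_bij[OF G g]])
      fix B :: "nat set" assume "finite B"
      then obtain xs where xs: "set xs = B"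
        using finite_list by blast
      have "same_orbit H xs (map g xs)"
        unfolding eq[symmetric] same_orbit_def using g by blast
      then show "\<exists>h\<in>H. \<forall>x\<in>B. h x = g x"
        unfolding same_orbit_def xs[symmetric] by simp
    qed
  qed
  from this[OF G H eq] this[OF H G eq[symmetric]] show ?thesis by blast
qed

definition same_type ::
  "(nat \<Rightarrow> nat) set \<Rightarrow> (nat \<Rightarrow> nat) set \<Rightarrow> nat list \<Rightarrow> nat list \<Rightarrow> bool" where
  "same_type G H a b \<longleftrightarrow> length a = length b \<and> (\<forall>f. sat f (same_orbit G) a \<longleftrightarrow> sat f (same_orbit H) b)"

lemma same_type_sym: "same_type G H a b \<Longrightarrow> same_type H G b a"
  unfolding same_type_def by metis

text \<open>The formula isolating the type of \<open>a @ [x]\<close> is realised over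
  \<open>b\<close>, because its existential closure belongs to the common type. It decides every
  \<open>h\<close> over \<open>b\<close> as over \<open>a\<close>, since the absence of a
  realisation of \<open>Conj f (Neg h)\<close> is also part of that type.\<close>

lemma same_type_extend:
  assumes G: "oligomorphic G" and H: "closed_subgroup H" and ab: "same_type G H a b"
  obtains y where "same_type G H (a @ [x]) (b @ [y])"
proof -
  have G': "closed_subgroup G"
    using G unfolding oligomorphic_iff by blast
  obtain f where f: "sat f (same_orbit G) (a @ [x])"
    "\<And>e' h. length e' = length (a @ [x]) \<Longrightarrow> sat f (same_orbit G) e' \<Longrightarrow>
      sat h (same_orbit G) e' \<longleftrightarrow> sat h (same_orbit G) (a @ [x])"
    using type_isolated[OF G, of "a @ [x]"] by blast
  have ex: "sat (Exists 1 h) (same_orbit K) e \<longleftrightarrow> (\<exists>y. sat h (same_orbit K) (e @ [y]))"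
    if "closed_subgroup K" for h K e
    unfolding sat.simps points_same_orbit[OF that] by (auto simp: length_Suc_conv)
  have tp: "sat h (same_orbit G) a \<longleftrightarrow> sat h (same_orbit H) b" for h
    using ab unfolding same_type_def by blast
  have "sat (Exists 1 f) (same_orbit H) b"
    unfolding tp[symmetric] ex[OF G'] using f(1) by blast
  then obtain y where y: "sat f (same_orbit H) (b @ [y])"
    unfolding ex[OF H] by blast
  have half: "sat h (same_orbit H) (b @ [y])" if "sat h (same_orbit G) (a @ [x])" for h
  proof -
    have "\<not> sat (Exists 1 (Conj f (Neg h))) (same_orbit G) a"
      unfolding ex[OF G'] using f(2) that by auto
    then have "\<not> sat (Exists 1 (Conj f (Neg h))) (same_orbit H) b"
      unfolding tp .
    then show ?thesis
      unfolding ex[OF H] using y by auto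
  qed
  have "sat h (same_orbit G) (a @ [x]) \<longleftrightarrow> sat h (same_orbit H) (b @ [y])" for h
    using half[of h] half[of "Neg h"] by auto
  moreover have "length a = length b"
    using ab unfolding same_type_def by simp
  ultimately have "same_type G H (a @ [x]) (b @ [y])"
    unfolding same_type_def length_append by auto
  then show thesis
    by (rule that)
qed

lemma same_type_atom:
  assumes "same_type G H a b" and "set u \<union> set v \<subseteq> {..<length a}"
  shows "same_orbit G (map (nth a) u) (map (nth a) v) \<longleftrightarrow> same_orbit H (map (nth b) u) (map (nth b) v)"
proof -
  have "sat (Atom u v) (same_orbit G) a \<longleftrightarrow> sat (Atom u v) (same_orbit H) b"
    using assms(1) unfolding same_type_def by blast
  moreover have "length b = length a"
    using assms(1) unfolding same_type_def by simp
  ultimately show ?thesis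
    using assms(2) by simp
qed

lemma same_orbit_eq_iff: "closed_subgroup G \<Longrightarrow> same_orbit G [x, x] [x, y] \<longleftrightarrow> x = y"
  using same_orbit_refl[of G "[x, x]"] unfolding same_orbit_def by auto

lemma same_type_nth_eq_iff:
  assumes G: "closed_subgroup G" and H: "closed_subgroup H"
    and "same_type G H a b" and "i < length a" and "j < length a"
  shows "a ! i = a ! j \<longleftrightarrow> b ! i = b ! j"
  using same_type_atom[OF assms(3), of "[i, i]" "[i, j]"] assms(4,5)
  by (simp add: same_orbit_eq_iff[OF G] same_orbit_eq_iff[OF H])

text \<open>Back and forth with growing tuples in place of finite partial maps. Repeated entries are
  allowed: equality of entries is an atom, hence agrees on both sides.\<close>

lemma same_type_conjugation:
  assumes G: "oligomorphic G" and H: "oligomorphic H" and nil: "same_type G H [] []"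
  obtains \<sigma> where "bij \<sigma>"
    and "\<And>xs ys. same_orbit G xs ys \<longleftrightarrow> same_orbit H (map \<sigma> xs) (map \<sigma> ys)"
proof -
  have G': "closed_subgroup G" and H': "closed_subgroup H"
    using G H unfolding oligomorphic_iff by blast+
  let ?P = "\<lambda>n (a, b). same_type G H a b \<and> {..<n} \<subseteq> set a \<and> {..<n} \<subseteq> set b"
  let ?Q = "\<lambda>n (a, b) (a', b'). \<exists>u v. a' = a @ u \<and> b' = b @ v"
  have "\<exists>f. \<forall>n :: nat. ?P n (f n) \<and> ?Q n (f n) (f (Suc n))"
  proof (rule dependent_nat_choice)
    show "\<exists>c. ?P 0 c"
      using nil by auto
    fix c :: "nat list \<times> nat list" and n assume "?P n c"
    then obtain a b where c: "c = (a, b)" and ab: "same_type G H a b" "{..<n} \<subseteq> set a" "{..<n} \<subseteq> set b"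
      by (cases c) auto
    \<comment> \<open>Forth and then back: \<open>n\<close> is added to the first tuple and answered
      by \<open>y\<close>, then added to the second and answered by \<open>x\<close>.\<close>
    obtain y where y: "same_type G H (a @ [n]) (b @ [y])"
      using same_type_extend[OF G H' ab(1)] .
    obtain x where "same_type H G ((b @ [y]) @ [n]) ((a @ [n]) @ [x])"
      using same_type_extend[OF H G' same_type_sym[OF y]] .
    then have "same_type G H (a @ [n, x]) (b @ [y, n])"
      by (auto dest: same_type_sym)
    moreover have "{..<Suc n} \<subseteq> set (a @ [n, x])" "{..<Suc n} \<subseteq> set (b @ [y, n])"
      using ab(2,3) by (auto simp: less_Suc_eq)
    ultimately show "\<exists>c'. ?P (Suc n) c' \<and> ?Q n c c'"
      unfolding c by (intro exI[of _ "(a @ [n, x], b @ [y, n])"]) auto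
  qed
  then obtain f where f: "\<forall>n :: nat. ?P n (f n) \<and> ?Q n (f n) (f (Suc n))"
    by (elim exE)
  define a b where "a n = fst (f n)" and "b n = snd (f n)" for n
  have tp: "same_type G H (a n) (b n)" and cover: "{..<n} \<subseteq> set (a n)" "{..<n} \<subseteq> set (b n)" for n
    using spec[OF f, of n] unfolding a_def b_def by (auto simp: case_prod_unfold)
  have len: "length (b n) = length (a n)" for n
    using tp unfolding same_type_def by simp
  have step: "\<exists>u v. a (Suc n) = a n @ u \<and> b (Suc n) = b n @ v" for n
    using spec[OF f, of n] unfolding a_def b_def by (auto simp: case_prod_unfold)
  have mono: "\<exists>u v. a m = a n @ u \<and> b m = b n @ v" if "n \<le> m" for n m
    using that
  proof (induction m rule: dec_induct)
    case (step m)
    then show ?case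
      using \<open>\<And>n. \<exists>u v. a (Suc n) = a n @ u \<and> b (Suc n) = b n @ v\<close>[of m] by auto
  qed simp
  have nth: "i < length (a m)" "a m ! i = a n ! i" "b m ! i = b n ! i" if "n \<le> m" "i < length (a n)" for i n m
    using mono[OF that(1)] that(2) len[of n] by (auto simp: nth_append)
  have "\<exists>i<length (a (Suc x)). a (Suc x) ! i = x" for x
    using cover(1)[of "Suc x"] by (metis in_set_conv_nth lessI lessThan_iff subsetD)
  then obtain pos where pos: "\<And>x. pos x < length (a (Suc x))" "\<And>x. a (Suc x) ! pos x = x"
    by metis
  define \<sigma> where "\<sigma> x = b (Suc x) ! pos x" for x
  \<comment> \<open>Independence of the chosen position: at a common later stage \<open>?M\<close>
    both occurrences of the number in the first tuple must have equal partners in the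
    second.\<close>
  have \<sigma>: "\<sigma> (a m ! i) = b m ! i" if i: "i < length (a m)" for m i
  proof -
    let ?x = "a m ! i" and ?M = "max m (Suc (a m ! i))"
    have i': "i < length (a ?M)" "a ?M ! i = ?x" "b ?M ! i = b m ! i"
      using nth[of m ?M i] i by simp_all
    have j': "pos ?x < length (a ?M)" "a ?M ! pos ?x = ?x" "b ?M ! pos ?x = \<sigma> ?x"
      using nth[of "Suc ?x" ?M "pos ?x"] pos[of ?x] unfolding \<sigma>_def by simp_all
    show ?thesis
      using same_type_nth_eq_iff[OF G' H' tp[of ?M] j'(1) i'(1)] i'(2,3) j'(2,3) by metis
  qed
  have index: "\<exists>w. set w \<subseteq> {..<length (a m)} \<and> xs = map (nth (a m)) w" if "set xs \<subseteq> {..<m}" for xs m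
  proof -
    have "set (a m) = nth (a m) ` {..<length (a m)}"
      by (simp add: lessThan_atLeast0 nth_image)
    then have "set xs \<subseteq> nth (a m) ` {..<length (a m)}"
      using that cover(1)[of m] by blast
    then have "xs \<in> lists (nth (a m) ` {..<length (a m)})"
      by blast
    then have "xs \<in> map (nth (a m)) ` lists {..<length (a m)}"
      by (simp add: lists_image)
    then show ?thesis by auto
  qed
  have "same_orbit G xs ys \<longleftrightarrow> same_orbit H (map \<sigma> xs) (map \<sigma> ys)" for xs ys
  proof -
    obtain m where "\<forall>x\<in>set xs \<union> set ys. x < m"
      using finite_nat_set_iff_bounded[of "set xs \<union> set ys"] by auto
    then have "set xs \<subseteq> {..<m}" "set ys \<subseteq> {..<m}" by auto
    then obtain u v where uv: "set u \<subseteq> {..<length (a m)}" "xs = map (nth (a m)) u"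
      "set v \<subseteq> {..<length (a m)}" "ys = map (nth (a m)) v"
      using index by metis
    then have im: "map \<sigma> xs = map (nth (b m)) u" "map \<sigma> ys = map (nth (b m)) v"
      using \<sigma> by auto
    show ?thesis
      unfolding im unfolding uv(2,4) by (rule same_type_atom[OF tp]) (use uv(1,3) in blast)
  qed
  moreover have "bij \<sigma>"
  proof (rule bijI)
    show "inj \<sigma>"
    proof (rule injI)
      fix x y assume eq: "\<sigma> x = \<sigma> y"
      let ?M = "max (Suc x) (Suc y)"
      have "pos x < length (a ?M)" "a ?M ! pos x = x" "b ?M ! pos x = \<sigma> x"
        using nth[of "Suc x" ?M "pos x"] pos[of x] unfolding \<sigma>_def by simp_all
      moreover have "pos y < length (a ?M)" "a ?M ! pos y = y" "b ?M ! pos y = \<sigma> y"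
        using nth[of "Suc y" ?M "pos y"] pos[of y] unfolding \<sigma>_def by simp_all
      ultimately show "x = y"
        using same_type_nth_eq_iff[OF G' H' tp[of ?M], of "pos x" "pos y"] eq by metis
    qed
    have "\<exists>x. \<sigma> x = y" for y
    proof -
      have "y \<in> set (b (Suc y))"
        using cover(2)[of "Suc y"] by auto
      then obtain i where "i < length (a (Suc y))" "b (Suc y) ! i = y"
        using len by (metis in_set_conv_nth)
      then show ?thesis
        using \<sigma>[of i "Suc y"] by auto
    qed
    then show "surj \<sigma>"
      by (metis surj_def)
  qed
  ultimately show thesis
    using that by blast
qed

text \<open>Conjugation by \<open>\<sigma>\<close> is treated as a quotient action on singleton
  tuples, with \<open>[x]\<close> named \<open>\<sigma> x\<close>. The image group has the orbits of
  \<open>H\<close>, hence equals \<open>H\<close>.\<close>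

lemma same_type_isomorphic:
  assumes G: "oligomorphic G" and H: "oligomorphic H" and "same_type G H [] []"
  shows "topologically_isomorphic G H"
proof -
  have G': "closed_subgroup G" and H': "closed_subgroup H"
    using G H unfolding oligomorphic_iff by blast+
  obtain \<sigma> where \<sigma>: "bij \<sigma>" "\<And>xs ys. same_orbit G xs ys \<longleftrightarrow> same_orbit H (map \<sigma> xs) (map \<sigma> ys)"
    using same_type_conjugation[OF assms] by blast
  interpret equivariant_quotient G "range (\<lambda>x. [x])" "\<lambda>b. \<sigma> (hd b)"
  proof
    show "\<exists>bs. set bs \<subseteq> range (\<lambda>x. [x]) \<and> (\<forall>g\<in>G. (\<forall>b\<in>set bs. \<sigma> (hd (map g b)) = \<sigma> (hd b)) \<longrightarrow> g x = x)" for x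
      using \<sigma>(1) by (intro exI[of _ "[[x]]"]) (auto dest: bij_is_inj injD)
    show "(\<lambda>b. \<sigma> (hd b)) ` range (\<lambda>x. [x]) = UNIV"
      using \<sigma>(1) by (simp add: image_image bij_is_surj)
  qed (use G' in \<open>auto simp: inj_eq[OF bij_is_inj[OF \<sigma>(1)]]\<close>)
  have "same_orbit (act ` G) xs ys \<longleftrightarrow> same_orbit H xs ys" for xs ys
  proof -
    obtain us vs where uv: "xs = map \<sigma> us" "ys = map \<sigma> vs"
      using \<sigma>(1) by (metis bij_is_surj ex_map_conv surj_def)
    have xs: "xs = map (\<lambda>b. \<sigma> (hd b)) (map (\<lambda>x. [x]) us)"
      by (simp add: uv)
    have "same_orbit (act ` G) xs ys \<longleftrightarrow> (\<exists>g\<in>G. map \<sigma> (map g us) = map \<sigma> vs)"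
      unfolding xs by (subst same_orbit_image_iff) (auto simp: uv comp_def)
    also have "\<dots> \<longleftrightarrow> same_orbit G us vs"
      using \<sigma>(1) unfolding same_orbit_def by (metis bij_is_inj inj_map_eq_map)
    finally show ?thesis
      using \<sigma>(2) uv by simp
  qed
  then have "act ` G = H"
    by (intro closed_subgroup_eqI[OF closed_subgroup_image H'] ext) blast
  then show ?thesis
    using topologically_isomorphic_image by simp
qed

subsection \<open>Interpretations and isomorphism\<close>

lemma concat_inject:
  "map length xs = map length ys \<Longrightarrow> concat xs = concat ys \<Longrightarrow> xs = ys"
proof (induction xs arbitrary: ys)
  case (Cons x xs)
  then show ?case by (cases ys) auto
qed simp

lemma interp_eq_same_orbit_iff:
  assumes "closed_subgroup G"
  shows "interp_eq (same_orbit G) z n x y \<longleftrightarrow>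
    (\<exists>(l, w) \<in> set n. length x = l \<and> set w \<subseteq> {..<length z} \<and> same_orbit G (x @ y) (map (nth z) w))"
  unfolding interp_eq_def points_same_orbit[OF assms] by simp

lemma interp_eq_invariant:
  assumes G: "closed_subgroup G" and g: "g \<in> G" and xy: "interp_eq (same_orbit G) z n x y"
  shows "interp_eq (same_orbit G) z n (map g x) (map g y)"
proof -
  obtain l w where lw: "(l, w) \<in> set n" "length x = l" "set w \<subseteq> {..<length z}"
    "same_orbit G (x @ y) (map (nth z) w)"
    using xy unfolding interp_eq_same_orbit_iff[OF G] by blast
  have "same_orbit G (x @ y) (map g x @ map g y)"
    unfolding same_orbit_def using g by (intro bexI[of _ g]) auto
  then have "same_orbit G (map g x @ map g y) (map (nth z) w)"
    using lw(4) same_orbit_sym[OF G] same_orbit_trans[OF G] by blast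
  then show ?thesis
    unfolding interp_eq_same_orbit_iff[OF G] using lw(1-3) by (intro bexI[OF _ lw(1)]) auto
qed

context equivariant_quotient
begin

lemma concat_map_same_orbit_iff:
  assumes "map length ds = map length bs"
  shows "same_orbit G (concat bs) (concat ds) \<longleftrightarrow> (\<exists>g\<in>G. ds = map (map g) bs)"
proof -
  have "map g (concat bs) = concat ds \<longleftrightarrow> ds = map (map g) bs" for g
    using concat_inject[of ds "map (map g) bs"] assms by (auto simp: map_concat comp_def)
  then show ?thesis
    unfolding same_orbit_def by blast
qed

text \<open>Decoding a number and taking its class is a correspondence \<open>?R\<close> from the
  interpreted structure to the orbit structure of the image group, with many codes over each
  point.\<close>

lemma sat_image:
  assumes eq: "\<And>x y. interp_eq (same_orbit G) z n x y \<longleftrightarrow> x \<in> D \<and> y \<in> D \<and> p x = p y"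
  shows "sat f (same_orbit (act ` G)) [] \<longleftrightarrow> sat f (interp (same_orbit G) z n) []"
proof -
  let ?R = "\<lambda>u x. from_nat u \<in> D \<and> p (from_nat u) = x"
  have split: "set us \<subseteq> from_nat -` D \<and> xs = map p (map from_nat us)" if "list_all2 ?R us xs" for us xs
    using that by (auto simp: list_all2_conv_all_nth in_set_conv_nth intro!: nth_equalityI)
  have rel: "interp (same_orbit G) z n us vs \<longleftrightarrow> same_orbit (act ` G) xs ys"
    if us: "list_all2 ?R us xs" and vs: "list_all2 ?R vs ys" for us vs xs ys
  proof -
    let ?bs = "map from_nat us :: nat list list" and ?cs = "map from_nat vs :: nat list list"
    have D: "set ?bs \<subseteq> D" "set ?cs \<subseteq> D" and xs: "xs = map p ?bs" and ys: "ys = map p ?cs"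
      using split[OF us] split[OF vs] by auto
    have pointwise: "list_all2 (interp_eq (same_orbit G) z n) ds ?cs \<longleftrightarrow> map p ds = map p ?cs" if "set ds \<subseteq> D" for ds
      using that D(2) unfolding eq list_all2_conv_all_nth list_eq_iff_nth_eq
      by (auto simp: subset_iff)
    have img: "set (map (map g) ?bs) \<subseteq> D" if "g \<in> G" for g
      using D(1) D_invariant that by auto
    have "interp (same_orbit G) z n us vs \<longleftrightarrow>
        (\<exists>ds. map length ds = map length ?bs \<and> same_orbit G (concat ?bs) (concat ds) \<and>
          list_all2 (interp_eq (same_orbit G) z n) ds ?cs)"
      using D unfolding interp_def by (auto simp: eq)
    also have "\<dots> \<longleftrightarrow> (\<exists>g\<in>G. map p (map (map g) ?bs) = map p ?cs)"
    proof
      assume "\<exists>ds. map length ds = map length ?bs \<and> same_orbit G (concat ?bs) (concat ds) \<and>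
          list_all2 (interp_eq (same_orbit G) z n) ds ?cs"
      then obtain ds where ds: "map length ds = map length ?bs" "same_orbit G (concat ?bs) (concat ds)"
        "list_all2 (interp_eq (same_orbit G) z n) ds ?cs"
        by blast
      then obtain g where "g \<in> G" "ds = map (map g) ?bs"
        using concat_map_same_orbit_iff[OF ds(1)] by blast
      then show "\<exists>g\<in>G. map p (map (map g) ?bs) = map p ?cs"
        using ds(3) pointwise[OF img] by blast
    next
      assume "\<exists>g\<in>G. map p (map (map g) ?bs) = map p ?cs"
      then obtain g where g: "g \<in> G" "map p (map (map g) ?bs) = map p ?cs"
        by blast
      have len: "map length (map (map g) ?bs) = map length ?bs"
        by (simp add: comp_def)
      show "\<exists>ds. map length ds = map length ?bs \<and> same_orbit G (concat ?bs) (concat ds) \<and>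
          list_all2 (interp_eq (same_orbit G) z n) ds ?cs"
        using len concat_map_same_orbit_iff[OF len] pointwise[OF img[OF g(1)]] g by blast
    qed
    also have "\<dots> \<longleftrightarrow> same_orbit (act ` G) xs ys"
      unfolding xs ys by (rule same_orbit_image_iff[OF D(1), symmetric])
    finally show ?thesis .
  qed
  have "structure_rel ?R (interp (same_orbit G) z n) (same_orbit (act ` G))"
    unfolding structure_rel_def
  proof (intro conjI ballI allI impI)
    fix u assume "u \<in> points (interp (same_orbit G) z n)"
    from points_interp[OF this] show "\<exists>x\<in>points (same_orbit (act ` G)). ?R u x"
      unfolding eq points_same_orbit[OF closed_subgroup_image] by simp
  next
    fix x
    have R: "?R (to_nat (section_of x)) x"
      by (simp add: section_of)
    then have "interp (same_orbit G) z n [to_nat (section_of x)] [to_nat (section_of x)]"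
      using rel[of "[to_nat (section_of x)]" "[x]" "[to_nat (section_of x)]" "[x]"]
      by (simp add: same_orbit_refl[OF closed_subgroup_image])
    with R show "\<exists>u\<in>points (interp (same_orbit G) z n). ?R u x"
      unfolding points_def by blast
  qed (use rel in blast)
  from sat_cong[OF this, of "[]" "[]"] show ?thesis by simp
qed

text \<open>An \<open>n\<close>-tuple of classes is represented by \<open>n\<close> tuples of length
  at most \<open>L\<close>, whose concatenation can be moved into a finite set of representatives.
  The concatenation and the individual lengths, for which there are finitely many choices, recover
  the list.\<close>

lemma oligomorphic_image:
  assumes olig: "oligomorphic G" and bound: "\<And>b. b \<in> D \<Longrightarrow> length b \<le> L"
  shows "oligomorphic (act ` G)"
  unfolding oligomorphic_iff
proof (intro conjI allI closed_subgroup_image)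
  fix n
  obtain R where R: "\<And>m. finite (R m)" "\<And>xs. \<exists>r\<in>R (length xs). same_orbit G r xs"
    using olig unfolding oligomorphic_iff by metis
  define S where "S = {bs. set bs \<subseteq> D \<and> length bs = n \<and> concat bs \<in> (\<Union>m\<le>n * L. R m)}"
  have "inj_on (\<lambda>bs. (concat bs, map length bs)) S"
    by (auto intro!: inj_onI concat_inject)
  moreover have "(\<lambda>bs. (concat bs, map length bs)) ` S \<subseteq>
      (\<Union>m\<le>n * L. R m) \<times> {ls. set ls \<subseteq> {..L} \<and> length ls = n}"
    unfolding S_def by (auto intro!: bound)
  moreover have "finite ((\<Union>m\<le>n * L. R m) \<times> {ls. set ls \<subseteq> {..L} \<and> length ls = n})"
    using R(1) by (intro finite_cartesian_product finite_lists_length_eq) auto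
  ultimately have "finite S"
    using finite_imageD finite_subset by blast
  have "\<exists>r\<in>map p ` S. same_orbit (act ` G) r xs" if "length xs = n" for xs
  proof -
    let ?bs = "map section_of xs"
    have D: "set ?bs \<subseteq> D"
      using section_of(1) by auto
    have len: "length (concat bs) \<le> length bs * L" if "set bs \<subseteq> D" for bs
      using that bound by (induction bs) (auto intro: add_mono)
    obtain r where r: "r \<in> R (length (concat ?bs))" "same_orbit G r (concat ?bs)"
      using R(2) by blast
    obtain g where g: "g \<in> G" "map g (concat ?bs) = r"
      using same_orbit_sym[OF G r(2)] unfolding same_orbit_def by blast
    let ?cs = "map (map g) ?bs"
    have "set ?cs \<subseteq> D"
      using D D_invariant[OF _ g(1)] by auto
    moreover have "concat ?cs = r"
      using g(2) by (simp add: map_concat)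
    moreover have "length (concat ?bs) \<le> n * L"
      using len[OF D] \<open>length xs = n\<close> by simp
    ultimately have cs: "?cs \<in> S"
      unfolding S_def using r(1) \<open>length xs = n\<close> by auto
    have "same_orbit (act ` G) (map p ?bs) (map p ?cs)"
      unfolding same_orbit_image_iff[OF D] using g(1) by blast
    moreover have "map p ?bs = xs"
      by (simp add: section_of comp_def)
    ultimately have "same_orbit (act ` G) (map p ?cs) xs"
      using same_orbit_sym[OF closed_subgroup_image] by metis
    with cs show ?thesis
      by blast
  qed
  then show "\<exists>R. finite R \<and> (\<forall>xs. length xs = n \<longrightarrow> (\<exists>r\<in>R. same_orbit (act ` G) r xs))"
    using \<open>finite S\<close> by (intro exI[of _ "map p ` S"]) auto
qed

text \<open>The tuples \<open>bs\<close> provided by \<open>separating\<close> serve as the witness: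
  equal lengths allow \<open>concat\<close> to be cut back, so that \<open>cs\<close> is the image
  of \<open>bs\<close> under one element of \<open>G\<close>.\<close>

lemma interp_faithful_quotient:
  assumes eq: "\<And>x y. interp_eq (same_orbit G) z n x y \<longleftrightarrow> x \<in> D \<and> y \<in> D \<and> p x = p y"
  shows "interp_faithful (same_orbit G) z n"
proof -
  have "\<exists>bs. (\<forall>b\<in>set bs. interp_eq (same_orbit G) z n b b) \<and>
        (\<forall>y\<in>points (same_orbit G). \<forall>cs. list_all2 (interp_eq (same_orbit G) z n) bs cs \<longrightarrow>
           map length cs = map length bs \<longrightarrow>
           same_orbit G (x # concat bs) (y # concat cs) \<longrightarrow> same_orbit G [x, x] [x, y])" for x
  proof -
    obtain bs where bs: "set bs \<subseteq> D" "\<And>g. g \<in> G \<Longrightarrow> \<forall>b\<in>set bs. p (map g b) = p b \<Longrightarrow> g x = x"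
      using separating by metis
    have "x = y" if cs: "list_all2 (interp_eq (same_orbit G) z n) bs cs" "map length cs = map length bs"
      and orb: "same_orbit G (x # concat bs) (y # concat cs)" for y cs
    proof -
      obtain g where g: "g \<in> G" "g x = y" "map g (concat bs) = concat cs"
        using orb unfolding same_orbit_def by auto
      have "cs = map (map g) bs"
        using concat_inject[of cs "map (map g) bs"] cs(2) g(3) by (simp add: map_concat comp_def)
      then have "\<forall>b\<in>set bs. p (map g b) = p b"
        using cs(1) by (auto simp: list_all2_conv_all_nth eq in_set_conv_nth)
      then show ?thesis
        using bs(2)[OF g(1)] g(2) by simp
    qed
    then show ?thesis
      using bs(1) by (intro exI[of _ bs]) (auto simp: eq same_orbit_eq_iff[OF G])
  qed
  then show ?thesis
    unfolding interp_faithful_def by (auto simp: eq)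
qed

end

text \<open>With finitely many classes, faithfulness would make every orbit of points finite, while
  finitely many orbits cover the natural numbers. Infinitude is what allows the classes to be named
  bijectively by all natural numbers.\<close>

lemma interp_faithful_infinite:
  assumes olig: "oligomorphic G" and faithful: "interp_faithful (same_orbit G) z n"
  shows "infinite ((\<lambda>x. {y. interp_eq (same_orbit G) z n x y}) ` {x. interp_eq (same_orbit G) z n x x})"
    (is "infinite (?cls ` ?D)")
proof
  let ?Q = "interp_eq (same_orbit G) z n"
  assume fin: "finite (?cls ` ?D)"
  have G: "closed_subgroup G"
    using olig unfolding oligomorphic_iff by blast
  have fin_orbit: "finite ((\<lambda>g. g x) ` G)" for x
  proof -
    obtain bs where bs: "\<forall>b\<in>set bs. ?Q b b" and sep: "\<And>y cs. list_all2 ?Q bs cs \<Longrightarrow> map length cs = map length bs \<Longrightarrow>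
        same_orbit G (x # concat bs) (y # concat cs) \<Longrightarrow> x = y"
      using faithful unfolding interp_faithful_def points_same_orbit[OF G] same_orbit_eq_iff[OF G]
      by (metis UNIV_I)
    \<comment> \<open>The record of where \<open>g\<close> sends the classes of \<open>bs\<close>:
      it takes finitely many values and determines \<open>g x\<close>.\<close>
    let ?k = "\<lambda>g. map (\<lambda>b. ?cls (map g b)) bs"
    have "?k ` G \<subseteq> {ls. set ls \<subseteq> ?cls ` ?D \<and> length ls = length bs}"
      using bs interp_eq_invariant[OF G] by auto
    then have "finite (?k ` G)"
      using finite_lists_length_eq[OF fin] finite_subset by blast
    moreover have "g x = h x" if gh: "g \<in> G" "h \<in> G" "?k g = ?k h" for g h
    proof -
      let ?f = "inv_into UNIV g \<circ> h"
      note inv = closed_subgroup_inv[OF G gh(1)]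
      have "?Q b (map ?f b)" if b: "b \<in> set bs" for b
      proof -
        have "?cls (map g b) = ?cls (map h b)"
          using gh(3) b by simp
        moreover have "?Q (map h b) (map h b)"
          using interp_eq_invariant[OF G gh(2)] bs b by blast
        ultimately have "?Q (map g b) (map h b)"
          by blast
        from interp_eq_invariant[OF G inv this] show ?thesis
          by (simp add: closed_subgroup_inv_comp[OF G gh(1)])
      qed
      then have "list_all2 ?Q bs (map (map ?f) bs)"
        by (simp add: list_all2_conv_all_nth)
      moreover have "map length (map (map ?f) bs) = map length bs"
        by (simp add: comp_def)
      moreover have "same_orbit G (x # concat bs) (?f x # concat (map (map ?f) bs))"
        unfolding same_orbit_def
        by (rule bexI[OF _ closed_subgroup_comp[OF G inv gh(2)]]) (simp add: map_concat)
      ultimately have "x = ?f x"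
        by (rule sep)
      then show ?thesis
        using closed_subgroup_f_inv[OF G gh(1)] by (metis comp_apply)
    qed
    then have "(\<lambda>g. g x) ` G \<subseteq> (\<lambda>v. (SOME g. g \<in> G \<and> ?k g = v) x) ` ?k ` G"
    proof (intro subsetI)
      fix y assume "y \<in> (\<lambda>g. g x) ` G"
      then obtain g where g: "g \<in> G" "y = g x" by blast
      let ?s = "SOME h. h \<in> G \<and> ?k h = ?k g"
      have "?s \<in> G \<and> ?k ?s = ?k g"
        by (rule someI[of _ g]) (use g in simp)
      then have "y = ?s x"
        using \<open>\<And>h g. g \<in> G \<Longrightarrow> h \<in> G \<Longrightarrow> ?k g = ?k h \<Longrightarrow> g x = h x\<close>[OF g(1), of ?s] g(2) by simp
      then show "y \<in> (\<lambda>v. (SOME g. g \<in> G \<and> ?k g = v) x) ` ?k ` G"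
        using g(1) by blast
    qed
    ultimately show ?thesis
      using finite_surj finite_imageI by (metis (no_types, lifting))
  qed
  obtain R where R: "finite R" "\<And>xs. length xs = 1 \<Longrightarrow> \<exists>r\<in>R. same_orbit G r xs"
    using olig unfolding oligomorphic_iff by metis
  have "y \<in> (\<Union>r\<in>R. (\<lambda>g. g (hd r)) ` G)" for y
  proof -
    obtain r g where "r \<in> R" "g \<in> G" "map g r = [y]"
      using R(2)[of "[y]"] unfolding same_orbit_def by auto
    then show ?thesis
      by (intro UN_I[of r]) auto
  qed
  then have "UNIV = (\<Union>r\<in>R. (\<lambda>g. g (hd r)) ` G)"
    by blast
  moreover have "finite (\<Union>r\<in>R. (\<lambda>g. g (hd r)) ` G)"
    using R(1) fin_orbit by blast
  ultimately show False
    using infinite_UNIV_nat by metis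
qed

text \<open>Once the classes are enumerated, \<open>interp_faithful\<close> supplies the equivalence
  relation and the separating tuples of \<open>equivariant_quotient\<close>; invariance holds
  because \<open>interp_eq\<close> is a union of orbits.\<close>

lemma interp_realized:
  assumes olig: "oligomorphic G" and faithful: "interp_faithful (same_orbit G) z n"
  obtains H where "oligomorphic H" and "topologically_isomorphic G H"
    and "\<And>f. sat f (same_orbit H) [] \<longleftrightarrow> sat f (interp (same_orbit G) z n) []"
proof -
  let ?Q = "interp_eq (same_orbit G) z n"
  have G: "closed_subgroup G"
    using olig unfolding oligomorphic_iff by blast
  have sym: "?Q y x" if "?Q x y" for x y
    using faithful that unfolding interp_faithful_def by blast
  have trans: "?Q x v" if "?Q x y" "?Q y v" for x y v
    using faithful that unfolding interp_faithful_def by blast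
  define D where "D = {x. ?Q x x}"
  define cls where "cls x = {y. ?Q x y}" for x
  define p where "p x = to_nat_on (cls ` D) (cls x)" for x
  have "countable (cls ` D)"
    by simp
  moreover have "infinite (cls ` D)"
    using interp_faithful_infinite[OF assms] unfolding D_def cls_def .
  ultimately have bij: "bij_betw (to_nat_on (cls ` D)) (cls ` D) UNIV"
    by (rule to_nat_on_infinite)
  have eq: "?Q x y \<longleftrightarrow> x \<in> D \<and> y \<in> D \<and> p x = p y" for x y
  proof (cases "x \<in> D \<and> y \<in> D")
    case True
    then have "p x = p y \<longleftrightarrow> cls x = cls y"
      unfolding p_def using bij by (auto simp: bij_betw_def inj_on_eq_iff)
    also have "\<dots> \<longleftrightarrow> ?Q x y"
      using True sym trans unfolding cls_def D_def by blast
    finally show ?thesis using True by blast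
  next
    case False
    then show ?thesis
      using sym trans unfolding D_def by blast
  qed
  have D_inv: "map g b \<in> D" if "b \<in> D" "g \<in> G" for b g
    using that interp_eq_invariant[OF G] unfolding D_def by blast
  interpret equivariant_quotient G D p
  proof
    show "p ` D = UNIV"
      using bij unfolding p_def bij_betw_def by (simp add: image_image)
    show "p (map g b) = p (map g c)" if "b \<in> D" "c \<in> D" "g \<in> G" "p b = p c" for b c g
      using that eq interp_eq_invariant[OF G] by blast
    show "\<exists>bs. set bs \<subseteq> D \<and> (\<forall>g\<in>G. (\<forall>b\<in>set bs. p (map g b) = p b) \<longrightarrow> g x = x)" for x
    proof -
      obtain bs where bs: "\<forall>b\<in>set bs. ?Q b b" and sep: "\<And>y cs. list_all2 ?Q bs cs \<Longrightarrow> map length cs = map length bs \<Longrightarrow>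
          same_orbit G (x # concat bs) (y # concat cs) \<Longrightarrow> x = y"
        using faithful unfolding interp_faithful_def points_same_orbit[OF G] same_orbit_eq_iff[OF G]
        by (metis UNIV_I)
      have "g x = x" if g: "g \<in> G" "\<forall>b\<in>set bs. p (map g b) = p b" for g
      proof (rule sep[symmetric])
        show "list_all2 ?Q bs (map (map g) bs)"
          using bs g D_inv by (auto simp: list_all2_conv_all_nth eq)
        show "map length (map (map g) bs) = map length bs"
          by (simp add: comp_def)
        show "same_orbit G (x # concat bs) (g x # concat (map (map g) bs))"
          unfolding same_orbit_def by (rule bexI[OF _ g(1)]) (simp add: map_concat)
      qed
      then show ?thesis
        using bs unfolding D_def by (intro exI[of _ bs]) auto
    qed
  qed (use G D_inv in auto)
  \<comment> \<open>A tuple in \<open>D\<close> is related to itself, so its length occurs as a cut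
    in \<open>n\<close>.\<close>
  have bound: "length b \<le> Max (fst ` set n)" if "b \<in> D" for b
  proof -
    have "length b \<in> fst ` set n"
      using that unfolding D_def interp_eq_same_orbit_iff[OF G] by force
    then show ?thesis
      by (intro Max_ge) auto
  qed
  show thesis
    by (rule that[OF oligomorphic_image[OF olig bound] topologically_isomorphic_image sat_image[OF eq]])
qed

text \<open>An invariant relation between tuples of bounded length is a finite union of orbits of
  concatenated pairs, each stored with the place of its cut.\<close>

lemma invariant_definable:
  assumes olig: "oligomorphic G"
    and inv: "\<And>g x y. g \<in> G \<Longrightarrow> Q x y \<Longrightarrow> Q (map g x) (map g y)"
    and bound: "\<And>x y. Q x y \<Longrightarrow> length x \<le> L \<and> length y \<le> L"
  shows "\<exists>z n. \<forall>x y. interp_eq (same_orbit G) z n x y \<longleftrightarrow> Q x y"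
proof -
  have G: "closed_subgroup G"
    using olig unfolding oligomorphic_iff by blast
  obtain R where R: "\<And>m. finite (R m)" "\<And>xs. \<exists>r\<in>R (length xs). same_orbit G r xs"
    using olig unfolding oligomorphic_iff by metis
  define S where "S = {(l, r). l \<le> L \<and> r \<in> (\<Union>m\<le>L + L. R m) \<and> Q (take l r) (drop l r) \<and> l \<le> length r}"
  have "S \<subseteq> {..L} \<times> (\<Union>m\<le>L + L. R m)"
    unfolding S_def by auto
  then have "finite S"
    by (rule finite_subset) (use R(1) in auto)
  then obtain n where n: "set n = S"
    using finite_list by blast
  have "finite (\<Union>(l, r)\<in>S. set r)"
    using \<open>finite S\<close> by auto
  then obtain M where M: "\<And>l r x. (l, r) \<in> S \<Longrightarrow> x \<in> set r \<Longrightarrow> x < M"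
    by (metis (no_types, lifting) UN_I case_prod_conv finite_nat_set_iff_bounded)
  \<comment> \<open>Since \<open>M\<close> exceeds all entries involved, each representative is its
    own list of positions in the parameter tuple \<open>[0..<M]\<close>.\<close>
  have sel: "set r \<subseteq> {..<length [0..<M]}" "map (nth [0..<M]) r = r" if "(l, r) \<in> S" for l r
    using M[OF that] by (auto intro: map_idI)
  have "interp_eq (same_orbit G) [0..<M] n x y \<longleftrightarrow> Q x y" for x y
  proof
    assume "interp_eq (same_orbit G) [0..<M] n x y"
    then obtain r where r: "(length x, r) \<in> S" "same_orbit G (x @ y) (map (nth [0..<M]) r)"
      unfolding interp_eq_same_orbit_iff[OF G] n by auto
    then obtain g where g: "g \<in> G" "map g r = x @ y"
      using sel(2)[OF r(1)] same_orbit_sym[OF G] unfolding same_orbit_def by metis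
    have "Q (map g (take (length x) r)) (map g (drop (length x) r))"
      using r(1) inv[OF g(1)] unfolding S_def by blast
    then show "Q x y"
      by (simp add: take_map[symmetric] drop_map[symmetric] g(2))
  next
    assume Q: "Q x y"
    obtain r where r: "r \<in> R (length (x @ y))" "same_orbit G r (x @ y)"
      using R(2) by blast
    obtain g where g: "g \<in> G" "map g (x @ y) = r"
      using same_orbit_sym[OF G r(2)] unfolding same_orbit_def by blast
    have "take (length x) r = map g x" "drop (length x) r = map g y"
      unfolding g(2)[symmetric] by simp_all
    moreover have "r \<in> (\<Union>m\<le>L + L. R m)"
      using r(1) bound[OF Q] by (intro UN_I[of "length (x @ y)"]) auto
    ultimately have S: "(length x, r) \<in> S"
      unfolding S_def using bound[OF Q] inv[OF g(1) Q] g(2) by auto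
    show "interp_eq (same_orbit G) [0..<M] n x y"
      unfolding interp_eq_same_orbit_iff[OF G] n
      by (rule bexI[OF _ S]) (use sel[OF S] same_orbit_sym[OF G r(2)] in simp)
  qed
  then show ?thesis
    by blast
qed

text \<open>Through \<open>\<phi>\<close>, the group \<open>G\<close> acts on the points of
  \<open>H\<close> with finitely many orbits, represented by \<open>d\<close>. By continuity the
  stabiliser of \<open>i\<close> contains that of a finite tuple \<open>c i\<close>, so
  \<open>map g (c i)\<close> may represent the point \<open>\<phi> g i\<close>. Continuity of the
  inverse gives \<open>separating\<close>.\<close>

lemma isomorphic_interp:
  assumes oG: "oligomorphic G" and oH: "oligomorphic H" and iso: "topologically_isomorphic G H"
  obtains z n where "interp_faithful (same_orbit G) z n"
    and "\<And>f. sat f (same_orbit H) [] \<longleftrightarrow> sat f (interp (same_orbit G) z n) []"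
proof -
  have G: "closed_subgroup G" and H: "closed_subgroup H"
    using oG oH unfolding oligomorphic_iff by blast+
  obtain \<phi> where "topological_iso G H \<phi>"
    using iso topologically_isomorphic_iff[OF G H] by blast
  then have bij: "bij_betw \<phi> G H"
    and hom: "\<forall>g\<in>G. \<forall>h\<in>G. \<phi> (g \<circ> h) = \<phi> g \<circ> \<phi> h"
    and cont: "\<forall>x. \<exists>B. finite B \<and> (\<forall>g\<in>G. (\<forall>i\<in>B. g i = i) \<longrightarrow> \<phi> g x = x)"
      "\<forall>x. \<exists>B. finite B \<and> (\<forall>g\<in>G. (\<forall>i\<in>B. \<phi> g i = i) \<longrightarrow> g x = x)"
    unfolding topological_iso_def by simp_all
  have im: "\<phi> ` G = H"
    using bij by (simp add: bij_betw_def)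
  obtain R where R: "finite R" "\<And>xs. length xs = 1 \<Longrightarrow> \<exists>r\<in>R. same_orbit H r xs"
    using oH unfolding oligomorphic_iff by metis
  define d where "d = hd ` R"
  have "finite d"
    using R(1) unfolding d_def by simp
  have cover: "\<exists>g\<in>G. \<exists>i\<in>d. \<phi> g i = y" for y
  proof -
    obtain r h where "r \<in> R" "h \<in> H" "map h r = [y]"
      using R(2)[of "[y]"] unfolding same_orbit_def by auto
    moreover from \<open>h \<in> H\<close> obtain g where "g \<in> G" "h = \<phi> g"
      unfolding im[symmetric] by blast
    ultimately show ?thesis
      unfolding d_def by (intro bexI[of _ g] bexI[of _ "hd r"]) auto
  qed
  obtain B where B: "\<And>x. finite (B x)" "\<And>x g. g \<in> G \<Longrightarrow> \<forall>i\<in>B x. g i = i \<Longrightarrow> \<phi> g x = x"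
    using cont(1) by metis
  have "finite (\<Union>x\<in>d. B x)"
    using \<open>finite d\<close> B(1) by simp
  then obtain N where N: "\<forall>i\<in>(\<Union>x\<in>d. B x). i < N"
    using finite_nat_set_iff_bounded by blast
  \<comment> \<open>The tuples \<open>c i\<close> for distinct \<open>i\<close> have distinct lengths, hence lie in distinct orbits.\<close>
  define c where "c i = [0..<N + i]" for i
  have val: "i = j \<and> \<phi> g i = \<phi> h j"
    if "g \<in> G" "h \<in> G" "i \<in> d" "j \<in> d" and eq: "map g (c i) = map h (c j)" for g h i j
  proof -
    have "length (c i) = length (c j)"
      using arg_cong[OF eq, of length] by simp
    then have ij: "i = j"
      unfolding c_def by simp
    note inv = closed_subgroup_inv[OF G \<open>g \<in> G\<close>]
    have gh: "g k = h k" if "k < N" for k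
      using eq that unfolding ij c_def by simp
    have "\<phi> (inv_into UNIV g \<circ> h) i = i"
    proof (rule B(2)[OF closed_subgroup_comp[OF G inv \<open>h \<in> G\<close>]])
      show "\<forall>k\<in>B i. (inv_into UNIV g \<circ> h) k = k"
      proof
        fix k assume "k \<in> B i"
        then have "h k = g k"
          using N \<open>i \<in> d\<close> gh by simp
        then show "(inv_into UNIV g \<circ> h) k = k"
          by (simp add: closed_subgroup_inv_f[OF G \<open>g \<in> G\<close>])
      qed
    qed
    moreover have "g \<circ> (inv_into UNIV g \<circ> h) = h"
      by (auto simp: closed_subgroup_f_inv[OF G \<open>g \<in> G\<close>])
    ultimately show ?thesis
      using hom[rule_format, OF \<open>g \<in> G\<close> closed_subgroup_comp[OF G inv \<open>h \<in> G\<close>]] ij by (metis comp_apply)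
  qed
  define D where "D = {map g (c i) | g i. g \<in> G \<and> i \<in> d}"
  \<comment> \<open>The description is unique by \<open>val\<close>: a tuple in \<open>D\<close>
    determines \<open>i\<close> by its length and then \<open>\<phi> g i\<close> by its first
    \<open>N\<close> entries.\<close>
  define p where "p b = (THE y. \<exists>g\<in>G. \<exists>i\<in>d. b = map g (c i) \<and> y = \<phi> g i)" for b
  have p: "p (map g (c i)) = \<phi> g i" if gi: "g \<in> G" "i \<in> d" for g i
    unfolding p_def
  proof (rule the_equality)
    show "\<exists>h\<in>G. \<exists>j\<in>d. map g (c i) = map h (c j) \<and> \<phi> g i = \<phi> h j"
      using gi by blast
    fix y assume "\<exists>h\<in>G. \<exists>j\<in>d. map g (c i) = map h (c j) \<and> y = \<phi> h j"
    then obtain h j where "h \<in> G" "j \<in> d" "map g (c i) = map h (c j)" "y = \<phi> h j"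
      by blast
    then show "y = \<phi> g i"
      using val[of g h i j] gi by metis
  qed
  have D_inv: "map g b \<in> D" and p_map: "p (map g b) = \<phi> g (p b)" if b: "b \<in> D" and g: "g \<in> G" for g b
  proof -
    obtain h i where h: "h \<in> G" "i \<in> d" "b = map h (c i)"
      using b unfolding D_def by blast
    have eq: "map g b = map (g \<circ> h) (c i)"
      unfolding h(3) by simp
    have gh: "g \<circ> h \<in> G"
      by (rule closed_subgroup_comp[OF G g h(1)])
    show "map g b \<in> D"
      unfolding D_def eq using gh h(2) by blast
    show "p (map g b) = \<phi> g (p b)"
      unfolding eq p[OF gh h(2)] unfolding h(3) p[OF h(1,2)] using hom g h(1) by simp
  qed
  have onto: "\<exists>b\<in>D. p b = y" for y
    using cover[of y] p unfolding D_def by blast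
  interpret equivariant_quotient G D p
  proof
    show "p ` D = UNIV"
      using onto by (metis UNIV_eq_I image_eqI)
    show "\<exists>bs. set bs \<subseteq> D \<and> (\<forall>g\<in>G. (\<forall>b\<in>set bs. p (map g b) = p b) \<longrightarrow> g x = x)" for x
    proof -
      from spec[OF cont(2), of x]
      obtain C where C: "finite C" "\<forall>g\<in>G. (\<forall>i\<in>C. \<phi> g i = i) \<longrightarrow> g x = x"
        by (elim exE conjE)
      obtain q where q: "\<And>y. q y \<in> D" "\<And>y. p (q y) = y"
        using onto by metis
      obtain ys where ys: "set ys = C"
        using finite_list[OF C(1)] by blast
      have "g x = x" if g: "g \<in> G" "\<forall>b\<in>set (map q ys). p (map g b) = p b" for g
      proof -
        have "\<forall>i\<in>C. \<phi> g i = i"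
          using g(2) p_map[OF q(1) g(1)] q(2) unfolding ys[symmetric] by simp
        then show ?thesis
          using C(2) g(1) by blast
      qed
      then show ?thesis
        using q(1) by (intro exI[of _ "map q ys"]) auto
    qed
  qed (use G D_inv p_map in auto)
  have "act g = \<phi> g" if "g \<in> G" for g
    unfolding act_def using p_map[OF section_of(1) that] section_of(2) by auto
  then have H_eq: "act ` G = H"
    unfolding im[symmetric] by (intro image_cong) auto
  define L where "L = N + Max d"
  have bound: "length b \<le> L" if "b \<in> D" for b
    using that Max_ge[OF \<open>finite d\<close>] unfolding D_def c_def L_def by auto
  let ?Q = "\<lambda>x y. x \<in> D \<and> y \<in> D \<and> p x = p y"
  have inv: "?Q (map g x) (map g y)" if "g \<in> G" "?Q x y" for g x y
    using that D_inv p_map by auto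
  have bound2: "length x \<le> L \<and> length y \<le> L" if "?Q x y" for x y
    using that bound by blast
  have "\<exists>z n. \<forall>x y. interp_eq (same_orbit G) z n x y \<longleftrightarrow> ?Q x y"
    by (rule invariant_definable[OF oG, of ?Q L]) (fact inv bound2)+
  then obtain z n where "\<forall>x y. interp_eq (same_orbit G) z n x y \<longleftrightarrow> ?Q x y"
    by (elim exE)
  then have zn: "interp_eq (same_orbit G) z n x y \<longleftrightarrow> x \<in> D \<and> y \<in> D \<and> p x = p y" for x y
    by blast
  show thesis
    by (rule that[OF interp_faithful_quotient[OF zn] sat_image[OF zn, unfolded H_eq]])
qed

subsection \<open>Borel reduction\<close>

lemma standard_borel_baire: "standard_borel (borel :: (nat \<Rightarrow> nat) measure)"
  unfolding standard_borel_def
proof (intro exI[of _ euclidean] conjI)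
  show "completely_metrizable_space (euclidean :: (nat \<Rightarrow> nat) topology)"
  proof -
    have "discrete_topology UNIV = (euclidean :: nat topology)"
      by (simp add: discrete_topology_unique open_openin[symmetric] open_discrete)
    note this[symmetric]
    then show ?thesis
      unfolding euclidean_product_topology[symmetric]
      by (simp add: completely_metrizable_space_product_topology completely_metrizable_space_discrete_topology)
  qed
  obtain B :: "(nat \<Rightarrow> nat) set set" where "countable B" "topological_basis B"
    using ex_countable_basis by blast
  then have "second_countable (euclidean :: (nat \<Rightarrow> nat) topology)"
    unfolding second_countable_def open_openin[symmetric]
    by (metis topological_basisE topological_basis_open)
  then show "separable_space (euclidean :: (nat \<Rightarrow> nat) topology)"
    by (rule second_countable_imp_separable_space)
qed (auto simp: borel_def)

section \<open>Theories as points of Baire space and the countable family of maps between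
  them\<close>

definition theory_code :: "(nat \<Rightarrow> nat) set \<Rightarrow> nat \<Rightarrow> nat" where
  "theory_code G k = (if sat (from_nat k) (same_orbit G) [] then 1 else 0)"

definition holds :: "(nat \<Rightarrow> nat) \<Rightarrow> fm \<Rightarrow> bool" where
  "holds A f \<longleftrightarrow> A (to_nat f) = 1"

lemma holds_theory_code: "holds (theory_code G) f \<longleftrightarrow> sat f (same_orbit G) []"
  unfolding holds_def theory_code_def by simp

lemma theory_code_eq_iff: "theory_code G = theory_code H \<longleftrightarrow> same_type G H [] []"
proof
  assume "theory_code G = theory_code H"
  then show "same_type G H [] []"
    unfolding same_type_def by (metis holds_theory_code)
qed (auto simp: same_type_def theory_code_def)

text \<open>The condition says that \<open>f\<close> isolates a complete type of \<open>m\<close>-tuples, whose realisations are faithful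
  parameters for the interpretation \<open>n\<close>; then the theory of the interpreted structure does not
  depend on the choice of the parameters.\<close>

definition reinterpret ::
  "fm \<times> nat \<times> (nat \<times> nat list) list \<Rightarrow> (nat \<Rightarrow> nat) \<Rightarrow> (nat \<Rightarrow> nat)" where
  "reinterpret c A = (case c of (f, m, n) \<Rightarrow>
     if holds A (Exists m (Conj f (Faithful n))) \<and>
        (\<forall>h. \<not> (holds A (Exists m (Conj f h)) \<and> holds A (Exists m (Conj f (Neg h)))))
     then (\<lambda>k. A (to_nat (Exists m (Conj f (Interp n (from_nat k)))))) else A)"

lemma sat_Exists_Nil:
  "closed_subgroup G \<Longrightarrow>
    sat (Exists m f) (same_orbit G) [] \<longleftrightarrow> (\<exists>z. length z = m \<and> sat f (same_orbit G) z)"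
  by (simp add: points_same_orbit)

text \<open>Stated for every code \<open>c\<close>, so that any chain of these maps that starts at a
  theory stays among theories of isomorphic groups. If the test fails, the map fixes the theory and
  \<open>G\<close> itself is the witness.\<close>

lemma reinterpret_realized:
  assumes olig: "oligomorphic G"
  obtains H where "oligomorphic H" and "topologically_isomorphic G H"
    and "reinterpret c (theory_code G) = theory_code H"
proof -
  obtain f m n where c: "c = (f, m, n)"
    by (cases c) auto
  let ?A = "theory_code G"
  have G: "closed_subgroup G"
    using olig unfolding oligomorphic_iff by blast
  show thesis
  proof (cases "holds ?A (Exists m (Conj f (Faithful n))) \<and>
      (\<forall>h. \<not> (holds ?A (Exists m (Conj f h)) \<and> holds ?A (Exists m (Conj f (Neg h)))))")
    case True
    then obtain z where z: "length z = m" "sat f (same_orbit G) z" "interp_faithful (same_orbit G) z n"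
      unfolding holds_theory_code sat_Exists_Nil[OF G] by auto
    \<comment> \<open>As \<open>f\<close> decides every formula, \<open>h\<close> holds at some
      realisation of \<open>f\<close> exactly when it holds at \<open>z\<close>.\<close>
    have complete: "sat (Exists m (Conj f h)) (same_orbit G) [] \<longleftrightarrow> sat h (same_orbit G) z" for h
      using True z(1,2) unfolding holds_theory_code sat_Exists_Nil[OF G] by (metis sat.simps(2,3))
    obtain H where H: "oligomorphic H" "topologically_isomorphic G H"
      "\<And>h. sat h (same_orbit H) [] \<longleftrightarrow> sat h (interp (same_orbit G) z n) []"
      using interp_realized[OF olig z(3)] by blast
    have "reinterpret c ?A = (\<lambda>k. ?A (to_nat (Exists m (Conj f (Interp n (from_nat k))))))"
      unfolding reinterpret_def c prod.case using True by (rule if_P)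
    also have "\<dots> = theory_code H"
      unfolding theory_code_def from_nat_to_nat complete sat.simps(6) H(3) ..
    finally show thesis
      by (rule that[OF H(1,2)])
  next
    case False
    then have "reinterpret c ?A = ?A"
      unfolding reinterpret_def c prod.case by (rule if_not_P)
    moreover have "topologically_isomorphic G G"
      by (rule same_type_isomorphic[OF olig olig]) (simp add: same_type_def)
    ultimately show thesis
      using that[OF olig] by blast
  qed
qed

lemma isomorphic_reinterpret:
  assumes oG: "oligomorphic G" and oH: "oligomorphic H" and "topologically_isomorphic G H"
  obtains c where "reinterpret c (theory_code G) = theory_code H"
proof -
  have G: "closed_subgroup G"
    using oG unfolding oligomorphic_iff by blast
  obtain z n where z: "interp_faithful (same_orbit G) z n"
    "\<And>h. sat h (same_orbit H) [] \<longleftrightarrow> sat h (interp (same_orbit G) z n) []"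
    using isomorphic_interp[OF assms] by blast
  obtain f where f: "sat f (same_orbit G) z"
    "\<And>e h. length e = length z \<Longrightarrow> sat f (same_orbit G) e \<Longrightarrow>
      sat h (same_orbit G) e \<longleftrightarrow> sat h (same_orbit G) z"
    using type_isolated[OF oG, of z] by blast
  have complete: "sat (Exists (length z) (Conj f h)) (same_orbit G) [] \<longleftrightarrow> sat h (same_orbit G) z" for h
    unfolding sat_Exists_Nil[OF G] sat.simps(3)
  proof
    assume "\<exists>e. length e = length z \<and> sat f (same_orbit G) e \<and> sat h (same_orbit G) e"
    then obtain e where e: "length e = length z" "sat f (same_orbit G) e" "sat h (same_orbit G) e"
      by (elim exE conjE)
    show "sat h (same_orbit G) z"
      using f(2)[OF e(1,2), of h] e(3) by simp
  next
    assume "sat h (same_orbit G) z"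
    with f(1) show "\<exists>e. length e = length z \<and> sat f (same_orbit G) e \<and> sat h (same_orbit G) e"
      by (intro exI[of _ z] conjI refl)
  qed
  let ?A = "theory_code G" and ?m = "length z"
  have "holds ?A (Exists ?m (Conj f (Faithful n))) \<and>
      (\<forall>h. \<not> (holds ?A (Exists ?m (Conj f h)) \<and> holds ?A (Exists ?m (Conj f (Neg h)))))"
    unfolding holds_theory_code complete using z(1) by simp
  then have "reinterpret (f, ?m, n) ?A = (\<lambda>k. ?A (to_nat (Exists ?m (Conj f (Interp n (from_nat k))))))"
    unfolding reinterpret_def prod.case by (rule if_P)
  also have "\<dots> = theory_code H"
    unfolding theory_code_def from_nat_to_nat complete sat.simps(6) z(2) ..
  finally show thesis
    by (rule that)
qed

text \<open>Chains make the relation transitive on all of Baire space, and there are still only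
  countably many of them. Between theories of oligomorphic groups a single map already
  suffices.\<close>

definition reachable :: "(nat \<Rightarrow> nat) \<Rightarrow> (nat \<Rightarrow> nat) \<Rightarrow> bool" where
  "reachable A B \<longleftrightarrow> (\<exists>cs. fold reinterpret cs A = B)"

lemma reachable_trans: "reachable A B \<Longrightarrow> reachable B C \<Longrightarrow> reachable A C"
  unfolding reachable_def by (metis comp_apply fold_append)

lemma reachable_realized:
  assumes "oligomorphic G"
  obtains H where "oligomorphic H" and "topologically_isomorphic G H"
    and "fold reinterpret cs (theory_code G) = theory_code H"
proof -
  have "\<exists>H. oligomorphic H \<and> topologically_isomorphic G H \<and> fold reinterpret cs (theory_code G) = theory_code H"
    using assms
  proof (induction cs arbitrary: G)
    case Nil
    have "topologically_isomorphic G G"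
      by (rule same_type_isomorphic[OF Nil Nil]) (simp add: same_type_def)
    with Nil show ?case by auto
  next
    case (Cons c cs)
    obtain K where K: "oligomorphic K" "topologically_isomorphic G K" "reinterpret c (theory_code G) = theory_code K"
      using reinterpret_realized[OF Cons.prems] .
    obtain H where "oligomorphic H" "topologically_isomorphic K H" "fold reinterpret cs (theory_code K) = theory_code H"
      using Cons.IH[OF K(1)] by blast
    then show ?case
      using K topologically_isomorphic_trans[OF K(2)] by auto
  qed
  then show thesis using that by blast
qed

text \<open>A chain from \<open>theory_code G\<close> ends in the theory of some group isomorphic to
  \<open>G\<close>; that group has the theory of \<open>H\<close>, and equal theories imply
  isomorphism.\<close>

lemma reachable_iff_isomorphic:
  assumes oG: "oligomorphic G" and oH: "oligomorphic H"
  shows "reachable (theory_code G) (theory_code H) \<longleftrightarrow> topologically_isomorphic G H"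
proof
  assume "reachable (theory_code G) (theory_code H)"
  then obtain cs where cs: "fold reinterpret cs (theory_code G) = theory_code H"
    unfolding reachable_def by blast
  obtain K where K: "oligomorphic K" "topologically_isomorphic G K" "fold reinterpret cs (theory_code G) = theory_code K"
    using reachable_realized[OF oG] .
  have "same_type K H [] []"
    using cs K(3) theory_code_eq_iff by metis
  then show "topologically_isomorphic G H"
    using topologically_isomorphic_trans[OF K(2)] same_type_isomorphic[OF K(1) oH] by blast
next
  assume "topologically_isomorphic G H"
  then obtain c where "reinterpret c (theory_code G) = theory_code H"
    using isomorphic_reinterpret[OF oG oH] by blast
  then have "fold reinterpret [c] (theory_code G) = theory_code H"
    by simp
  then show "reachable (theory_code G) (theory_code H)"
    unfolding reachable_def by blast
qed

text \<open>Mutual reachability is an equivalence relation on all of Baire space, also at points that are not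
  the theory of any group, so the image of \<^const>\<open>theory_code\<close> need not be shown to be Borel.\<close>

definition mutually_reachable :: "(nat \<Rightarrow> nat) rel" where
  "mutually_reachable = {(A, B). reachable A B \<and> reachable B A}"

lemma equiv_mutually_reachable: "equiv UNIV mutually_reachable"
proof (rule equivI)
  have "reachable A A" for A
    unfolding reachable_def by (rule exI[of _ "[]"]) simp
  then show "refl mutually_reachable"
    unfolding mutually_reachable_def by (auto intro: refl_onI)
  show "sym mutually_reachable"
    unfolding mutually_reachable_def by (auto intro: symI)
  show "trans mutually_reachable"
    unfolding mutually_reachable_def by (auto intro!: transI intro: reachable_trans)
qed simp

lemma countable_mutually_reachable_class: "countable (mutually_reachable `` {A})"
proof (rule countable_subset)
  show "mutually_reachable `` {A} \<subseteq> range (\<lambda>cs. fold reinterpret cs A)"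
    unfolding mutually_reachable_def reachable_def by auto
qed simp

section \<open>Measurability of mutual reachability\<close>

lemma pred_eq_nat:
  fixes u v :: "'a \<Rightarrow> nat"
  assumes u: "u \<in> borel_measurable M" and v: "v \<in> borel_measurable M"
  shows "Measurable.pred M (\<lambda>x. u x = v x)"
proof -
  have const: "Measurable.pred M (\<lambda>x. w x = k)" if "w \<in> borel_measurable M" for w :: "'a \<Rightarrow> nat" and k
  proof -
    have "w -` {k} \<inter> space M \<in> sets M"
      by (rule measurable_sets[OF that]) simp
    then show ?thesis
      by (simp add: pred_def vimage_def Int_def conj_commute)
  qed
  note [measurable] = const[OF u] const[OF v]
  have "Measurable.pred M (\<lambda>x. \<exists>k. u x = k \<and> v x = k)"
    by measurable
  moreover have "(\<lambda>x. \<exists>k. u x = k \<and> v x = k) = (\<lambda>x. u x = v x)"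
    by auto
  ultimately show ?thesis
    by simp
qed

lemma measurable_coordinate: "(\<lambda>A :: nat \<Rightarrow> nat. A k) \<in> borel_measurable borel"
  by (rule measurable_product_then_coordinatewise[OF measurable_ident_sets[OF refl]])

lemma measurable_reinterpret: "reinterpret c \<in> measurable borel borel"
proof -
  obtain f m n where c: "c = (f, m, n)"
    by (cases c) auto
  have [measurable]: "Measurable.pred borel (\<lambda>A. holds A h)" for h
    unfolding holds_def by (rule pred_eq_nat[OF measurable_coordinate]) simp
  note [measurable] = measurable_coordinate
  have "(\<lambda>A. reinterpret c A k) \<in> borel_measurable borel" for k
    unfolding reinterpret_def c prod.case if_distrib[of "\<lambda>A. A k"]
    by measurable
  then show ?thesis
    by (rule measurable_coordinatewise_then_product)
qed

lemma measurable_fold_reinterpret: "fold reinterpret cs \<in> measurable borel borel"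
proof (induction cs)
  case (Cons c cs)
  from measurable_comp[OF measurable_reinterpret[of c] Cons] show ?case
    by (simp add: comp_def)
qed (simp add: measurable_ident id_def)

text \<open>Reachability is a countable union over chains of graphs of Borel maps, each graph being
  a countable intersection over coordinates.\<close>

lemma mutually_reachable_measurable: "mutually_reachable \<in> sets (borel \<Otimes>\<^sub>M borel)"
proof -
  have fold: "Measurable.pred M (\<lambda>x. reachable (u x) (v x))"
    if u: "u \<in> measurable M borel" and v: "v \<in> measurable M borel" for u v and M :: "'a measure"
  proof -
    have [measurable]: "Measurable.pred M (\<lambda>x. fold reinterpret cs (u x) k = v x k)" for cs k
      by (rule pred_eq_nat; rule measurable_product_then_coordinatewise)
        (use measurable_compose[OF u measurable_fold_reinterpret] v in simp_all)
    show ?thesis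
      unfolding reachable_def fun_eq_iff by measurable
  qed
  have "Measurable.pred (borel \<Otimes>\<^sub>M borel) (\<lambda>x. reachable (fst x) (snd x) \<and> reachable (snd x) (fst x))"
    by (intro pred_intros_logic fold measurable_fst measurable_snd)
  moreover have "mutually_reachable = {x \<in> space (borel \<Otimes>\<^sub>M borel). reachable (fst x) (snd x) \<and> reachable (snd x) (fst x)}"
    unfolding mutually_reachable_def by (auto simp: space_pair_measure)
  ultimately show ?thesis
    by (simp add: pred_def)
qed

lemma countable_borel_equiv_mutually_reachable: "countable_borel_equiv borel mutually_reachable"
  unfolding countable_borel_equiv_def
  using equiv_mutually_reachable mutually_reachable_measurable countable_mutually_reachable_class
  by (auto elim!: quotientE)

section \<open>Measurability of the theory in the Effros Borel structure\<close>

lemma pred_interp_eq: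
  fixes E :: "'a \<Rightarrow> orbit_structure"
  assumes [measurable]: "\<And>xs ys. Measurable.pred M (\<lambda>G. E G xs ys)"
  shows "Measurable.pred M (\<lambda>G. interp_eq (E G) z n x y)"
proof -
  have [measurable]: "Measurable.pred M (\<lambda>G. set x \<subseteq> points (E G))" for x
    unfolding points_def subset_iff mem_Collect_eq by measurable
  show ?thesis
    unfolding interp_eq_def Bex_def case_prod_unfold by measurable
qed

lemma pred_list_all2:
  assumes [measurable]: "\<And>x y. Measurable.pred M (\<lambda>G. Q G x y)"
  shows "Measurable.pred M (\<lambda>G. list_all2 (Q G) xs ys)"
  unfolding list_all2_conv_all_nth by measurable

text \<open>All quantifiers range over countable sets of tuples or lists of tuples, so satisfaction
  is built by countable Boolean operations. The family \<open>E\<close> stays arbitrary because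
  \<open>Interp\<close> replaces it by the interpreted structures.\<close>

lemma pred_sat:
  fixes E :: "'a \<Rightarrow> orbit_structure"
  assumes "\<And>xs ys. Measurable.pred M (\<lambda>G. E G xs ys)"
  shows "Measurable.pred M (\<lambda>G. sat f (E G) e)"
  using assms
proof (induction f arbitrary: E e)
  case (Atom u v)
  note [measurable] = Atom
  show ?case unfolding sat.simps by measurable
next
  case (Neg f)
  note [measurable] = Neg.IH[OF Neg.prems]
  show ?case unfolding sat.simps by measurable
next
  case (Conj f g)
  note [measurable] = Conj.IH(1)[OF Conj.prems] Conj.IH(2)[OF Conj.prems]
  show ?case unfolding sat.simps by measurable
next
  case (Exists m f)
  note [measurable] = Exists.IH[OF Exists.prems] Exists.prems
  have [measurable]: "Measurable.pred M (\<lambda>G. set x \<subseteq> points (E G))" for x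
    unfolding points_def subset_iff mem_Collect_eq by measurable
  show ?case unfolding sat.simps by measurable
next
  case (Faithful n)
  note [measurable] = Faithful pred_interp_eq[OF Faithful] pred_list_all2[OF pred_interp_eq[OF Faithful]]
  show ?case
    unfolding sat.simps interp_faithful_def points_def Ball_def mem_Collect_eq by measurable
next
  case (Interp n f)
  note [measurable] = Interp.prems pred_interp_eq[OF Interp.prems] pred_list_all2[OF pred_interp_eq[OF Interp.prems]]
  have "Measurable.pred M (\<lambda>G. interp (E G) e n us vs)" for us vs
    unfolding interp_def Ball_def by measurable
  then show ?case
    unfolding sat.simps by (rule Interp.IH)
qed

lemma openin_same_orbit: "openin Sinf_top {g \<in> carrier Sinf. map g xs = ys}"
proof (subst openin_subopen, intro ballI)
  fix k assume k: "k \<in> {g \<in> carrier Sinf. map g xs = ys}"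
  let ?T = "carrier Sinf \<inter> {h. \<forall>x\<in>set xs. h x = k x}"
  have "openin Sinf_top ?T"
    using open_cylinder[of "set xs" k] by (auto simp: openin_open)
  moreover have "k \<in> ?T" "?T \<subseteq> {g \<in> carrier Sinf. map g xs = ys}"
    using k by auto
  ultimately show "\<exists>T. openin Sinf_top T \<and> k \<in> T \<and> T \<subseteq> {g \<in> carrier Sinf. map g xs = ys}"
    by blast
qed

lemma space_oligomorphic_groups: "space oligomorphic_groups = {G. oligomorphic G}"
proof -
  have "{G. oligomorphic G} \<subseteq> space (effros_borel Sinf_top)"
    unfolding effros_borel_def oligomorphic_def closed_subgroup_def by (subst space_measure_of) auto
  then show ?thesis
    unfolding oligomorphic_groups_def space_restrict_space by blast
qed

text \<open>The condition says that \<open>G\<close> meets the open set of permutations carrying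
  \<open>xs\<close> to \<open>ys\<close>, which is a generator of the Effros structure.\<close>

lemma pred_same_orbit: "Measurable.pred oligomorphic_groups (\<lambda>G. same_orbit G xs ys)"
proof -
  let ?U = "{g \<in> carrier Sinf. map g xs = ys}"
  have "{D. closedin Sinf_top D \<and> D \<inter> ?U \<noteq> {}} \<in> sets (effros_borel Sinf_top)"
    unfolding effros_borel_def using openin_same_orbit[of xs ys]
    by (subst sets_measure_of) (auto intro!: sigma_sets.Basic)
  then have "{G. oligomorphic G} \<inter> {D. closedin Sinf_top D \<and> D \<inter> ?U \<noteq> {}} \<in> sets oligomorphic_groups"
    unfolding oligomorphic_groups_def sets_restrict_space by (rule imageI)
  moreover have "{G. oligomorphic G} \<inter> {D. closedin Sinf_top D \<and> D \<inter> ?U \<noteq> {}} =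
      {G \<in> space oligomorphic_groups. same_orbit G xs ys}"
  proof (intro Set.set_eqI)
    fix G
    have "closedin Sinf_top G \<and> (G \<inter> ?U \<noteq> {} \<longleftrightarrow> same_orbit G xs ys)" if "oligomorphic G"
    proof -
      have "closed_subgroup G"
        using that unfolding oligomorphic_def by blast
      then show ?thesis
        using closed_subgroup_bij[of G] unfolding closed_subgroup_def same_orbit_def carrier_Sinf by blast
    qed
    then show "G \<in> {G. oligomorphic G} \<inter> {D. closedin Sinf_top D \<and> D \<inter> ?U \<noteq> {}} \<longleftrightarrow>
        G \<in> {G \<in> space oligomorphic_groups. same_orbit G xs ys}"
      unfolding space_oligomorphic_groups by blast
  qed
  ultimately show ?thesis
    by (simp add: pred_def)
qed

lemma measurable_theory_code: "theory_code \<in> measurable oligomorphic_groups borel"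
proof (rule measurable_coordinatewise_then_product)
  fix k
  note [measurable] = pred_sat[OF pred_same_orbit]
  show "(\<lambda>G. theory_code G k) \<in> borel_measurable oligomorphic_groups"
    unfolding theory_code_def by measurable
qed

theorem mainTheorem2:
  shows "essentially_countable oligomorphic_groups oligomorphic_iso"
proof -
  have "(G, H) \<in> oligomorphic_iso \<longleftrightarrow> (theory_code G, theory_code H) \<in> mutually_reachable"
    if oG: "oligomorphic G" and oH: "oligomorphic H" for G H
  proof -
    \<comment> \<open>Mutual reachability asks for chains both ways, so isomorphism is needed in
      both directions.\<close>
    have "topologically_isomorphic H G" if "topologically_isomorphic G H"
      using topologically_isomorphic_sym[OF _ _ that] oG oH unfolding oligomorphic_def by blast
    then show ?thesis
      unfolding oligomorphic_iso_def mutually_reachable_def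
      using reachable_iff_isomorphic[OF oG oH] reachable_iff_isomorphic[OF oH oG] oG oH by auto
  qed
  then have "borel_reducible oligomorphic_groups oligomorphic_iso borel mutually_reachable"
    unfolding borel_reducible_def space_oligomorphic_groups
    by (intro bexI[OF _ measurable_theory_code]) auto
  then show ?thesis
    unfolding essentially_countable_def
    using standard_borel_baire countable_borel_equiv_mutually_reachable by blast
qed

end
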